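(* Let $G$ be a graph with degree sequence $\pi=(d_1\le\dots\le d_n)$, with $n\ge 3$, and set $d_0=0$. Suppose that all of the following hold (where $i$ denotes an integer): (i) if $n$ is odd, then $d_{(n+1)/2}\ge\frac12(n+1)$; (ii) if $n$ is even, then $d_{(n-2)/2}\ge\frac12 n$ or $d_{(n+2)/2}\ge\frac12(n+2)$; (iii) for every $i$ with $0\le i\le\frac12(n-2)$: if $d_i\le i$ and $d_{i+1}\le i+1$, then $d_{n-i-1}\ge n-i-1$ or $d_{n-i}\ge n-i$; (iv) for every $i$ with $1\le i\le\frac12(n-5)$: if $d_{i-1}\le i$ and $d_{i+2}\le i+1$, then $d_{n-i-3}\ge n-i-2$ or $d_{n-i}\ge n-i-1$. Then $G$ contains a 2-factor.
   Context: Graphs are finite, undirected, without loops or multiple edges. The degree sequence of a graph on $n$ vertices is the sequence of its vertex degrees, here listed in nondecreasing order. A 2-factor of $G$ is a spanning subgraph of $G$ in which every vertex has degree exactly 2. By convention $d_0=0$. *)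

theory Defs
  imports Complex_Main "HOL-Library.Multiset"
begin

definition simple_graph :: "'a set \<Rightarrow> 'a set set \<Rightarrow> bool" where
  "simple_graph V E \<longleftrightarrow> finite V \<and> (\<forall>e\<in>E. e \<subseteq> V \<and> card e = 2)"

definition degree :: "'a set set \<Rightarrow> 'a \<Rightarrow> nat" where
  "degree E v = card {e \<in> E. v \<in> e}"

definition degree_sequence :: "'a set \<Rightarrow> 'a set set \<Rightarrow> nat list" where
  "degree_sequence V E = sorted_list_of_multiset (image_mset (degree E) (mset_set V))"

text \<open>
  The entry \<open>d\<^sub>i\<close> of the sequence \<open>d\<^sub>1 \<le> \<dots> \<le> d\<^sub>n\<close>, with the convention \<open>d\<^sub>0 = 0\<close>.
  The value is unspecified for \<open>i > n\<close>.
\<close>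
definition deg_entry :: "'a set \<Rightarrow> 'a set set \<Rightarrow> nat \<Rightarrow> nat" where
  "deg_entry V E i = (if i = 0 then 0 else degree_sequence V E ! (i - 1))"

text \<open>
  A spanning subgraph of \<open>(V, E)\<close> has the same vertex set \<open>V\<close>, so it is identified with its
  edge set \<open>F\<close>.
\<close>
definition two_factor :: "'a set \<Rightarrow> 'a set set \<Rightarrow> 'a set set \<Rightarrow> bool" where
  "two_factor V E F \<longleftrightarrow> F \<subseteq> E \<and> (\<forall>v\<in>V. degree F v = 2)"

end

theory Submission imports Defs
begin

text \<open>
  Write \<open>c k\<close> for the number of vertices of degree at most \<open>k\<close>. Since \<open>d\<^sub>j \<le> k\<close> says \<open>j \<le> c k\<close>, the
  failure of one of the four hypotheses is a statement \<open>bad_counts\<close> that bounds values of \<open>c\<close>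
  from below. Adding an edge can only decrease \<open>c\<close>, so if the theorem fails for a graph without a
  2-factor, it also fails for one that gains a 2-factor whenever two non-adjacent vertices
  \<open>u\<close>, \<open>v\<close> are joined. Such a graph is spanned by a path from \<open>u\<close> to \<open>v\<close> together with disjoint
  cycles (a path system), although it has no spanning family of disjoint cycles.

  Rerouting a path system as in the closure argument for Hamiltonian cycles shows
  \<open>deg u + deg v \<le> n - 1\<close>. In case of equality the counting is sharp, and gives a
  dichotomy: for consecutive \<open>x\<close>, \<open>y\<close> on the path or on one of the cycles, exactly one of the
  relations \<open>x \<sim> v\<close>, \<open>y \<sim> u\<close> holds. So the neighbourhood of \<open>u\<close> is the set of successors of the
  vertices missed by \<open>v\<close>, and the same holds for each path system obtained by moving an end to a
  vertex of equal degree. In contrast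
  to the Hamiltonian problem one may also close up two cycles at once, which forces the
  missed vertices to propagate along the path in steps of two (\<open>path_propagate\<close>).
  The consequence that is used throughout is that the last but one vertex \<open>m\<close> of the path is
  trapped if an inner vertex of the path is missed, or the second vertex sees a missed vertex besides \<open>u\<close>: its neighbours are \<open>v\<close> and neighbours of \<open>u\<close> (\<open>trapped_penultimate_interior\<close>,
  \<open>trapped_penultimate_spare\<close>).

  Choose non-adjacent \<open>u\<close>, \<open>v\<close> with maximal degree sum and \<open>h = deg u \<le> deg v\<close>. As in Chvatal's
  theorem, \<open>c h \<ge> h\<close> and \<open>c (n - h - 1) \<ge> n - h\<close>. The hypotheses then force the degree sum to
  be \<open>n - 1\<close> and \<open>n \<ge> 2 h + 3\<close>, and they provide further vertices of degree exactly \<open>h\<close> or \<open>n - h - 1\<close>.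
  If only \<open>h\<close> vertices have degree at most \<open>h\<close>, the trapped vertex has too large a degree
  (\<open>few_low_vertices_impossible\<close>). If as many as \<open>h\<close> vertices have degree at least \<open>n - h\<close>, they form
  the neighbourhood of each vertex of degree \<open>h\<close>, and a second vertex of degree \<open>n - h - 1\<close> has
  no place in the path system (\<open>few_high_vertices_impossible\<close>). Otherwise counting gives
  each vertex of degree \<open>h\<close> at least two non-neighbours of degree \<open>n - h - 1\<close> and vice versa, with
  three on one side by the last hypothesis, whereas the propagation of missed vertices allows
  at most two on both sides (\<open>many_twins_impossible\<close>).
\<close>

section \<open>Cycles as lists and vertex-disjoint cycle covers\<close>

definition is_cycle :: "('a \<Rightarrow> 'a \<Rightarrow> bool) \<Rightarrow> 'a list \<Rightarrow> bool" where
  "is_cycle adj C \<longleftrightarrow>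
     3 \<le> length C \<and> distinct C \<and> successively adj C \<and> adj (last C) (hd C)"

inductive cycle_cover :: "('a \<Rightarrow> 'a \<Rightarrow> bool) \<Rightarrow> 'a set \<Rightarrow> bool" for adj where
  empty: "cycle_cover adj {}"
| insert: "cycle_cover adj Z \<Longrightarrow> is_cycle adj C \<Longrightarrow> set C \<inter> Z = {} \<Longrightarrow> cycle_cover adj (set C \<union> Z)"

lemma is_cycle_nonempty: "is_cycle adj C \<Longrightarrow> C \<noteq> []"
  by (auto simp: is_cycle_def)

lemma is_cycle_rotate1:
  assumes "is_cycle adj C"
  shows "is_cycle adj (rotate1 C)"
proof -
  obtain x xs where C: "C = x # xs" using is_cycle_nonempty[OF assms] by (cases C) auto
  have "xs \<noteq> []" using assms C by (auto simp: is_cycle_def)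
  then show ?thesis using assms C
    by (auto simp: is_cycle_def successively_append_iff successively_Cons)
qed

lemma is_cycle_rotate: "is_cycle adj C \<Longrightarrow> is_cycle adj (rotate k C)"
  by (induction k) (auto intro: is_cycle_rotate1)

lemma rotate_hd_last:
  assumes "i < length C" "0 < i"
  shows "hd (rotate i C) = C ! i" "last (rotate i C) = C ! (i - 1)"
proof -
  have r: "rotate i C = drop i C @ take i C" using assms by (simp add: rotate_drop_take)
  show "hd (rotate i C) = C ! i" using assms r by (simp add: hd_drop_conv_nth)
  have "take i C \<noteq> []" using assms by auto
  then show "last (rotate i C) = C ! (i - 1)" using assms r
    by (simp add: last_conv_nth[of "take i C"])
qed

lemma cycle_cover_Un:
  "cycle_cover adj Z \<Longrightarrow> cycle_cover adj Y \<Longrightarrow> Z \<inter> Y = {} \<Longrightarrow> cycle_cover adj (Z \<union> Y)"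
proof (induction rule: cycle_cover.induct)
  case empty
  then show ?case by simp
next
  case (insert Z C)
  then have "cycle_cover adj (Z \<union> Y)" by blast
  moreover have "set C \<inter> (Z \<union> Y) = {}" using insert by blast
  ultimately show ?case using insert cycle_cover.insert[of adj "Z \<union> Y" C] by (simp add: Un_assoc)
qed

lemma cycle_cover_cycle: "is_cycle adj C \<Longrightarrow> cycle_cover adj (set C)"
  using cycle_cover.insert[OF cycle_cover.empty, of adj C] by simp

text \<open>
  A cycle of the cover can be singled out and read off from any prescribed vertex; this
  spares a separate representation of cyclic order.
\<close>
lemma cycle_cover_rotate_to:
  assumes "cycle_cover adj Z" "z \<in> Z"
  shows "\<exists>C. is_cycle adj C \<and> hd C = z \<and> set C \<subseteq> Z \<and> cycle_cover adj (Z - set C)"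
  using assms
proof (induction rule: cycle_cover.induct)
  case empty
  then show ?case by simp
next
  case (insert Z C)
  show ?case
  proof (cases "z \<in> set C")
    case True
    then obtain i where i: "i < length C" "C ! i = z" by (auto simp: in_set_conv_nth)
    have "hd (rotate i C) = z"
      using i rotate_hd_last(1)[of i C] by (cases "i = 0") (auto simp: hd_conv_nth)
    moreover have "set C \<union> Z - set C = Z" using insert by blast
    ultimately show ?thesis using insert is_cycle_rotate[of adj C i]
      by (intro exI[of _ "rotate i C"]) auto
  next
    case False
    then obtain D where D: "is_cycle adj D" "hd D = z" "set D \<subseteq> Z" "cycle_cover adj (Z - set D)"
      using insert by auto
    have "cycle_cover adj (set C \<union> (Z - set D))"
      using D insert by (intro cycle_cover.insert) auto
    moreover have "set C \<union> (Z - set D) = set C \<union> Z - set D" using D insert by blast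
    ultimately show ?thesis using D by (intro exI[of _ D]) auto
  qed
qed

text \<open>
  The counting step behind degree-sum arguments, in the form that also extracts what
  equality means. It is applied to a list \<open>xs\<close> and the list \<open>ys\<close> of the successors.
\<close>
lemma card_index_pair:
  assumes "distinct xs" "distinct ys" "length xs = k" "length ys = k"
    and excl: "\<And>i. i < k \<Longrightarrow> \<not> (A (xs ! i) \<and> B (ys ! i))"
  shows "card (Collect A \<inter> set xs) + card (Collect B \<inter> set ys) \<le> k"
    and "card (Collect A \<inter> set xs) + card (Collect B \<inter> set ys) = k \<Longrightarrow> i < k
           \<Longrightarrow> A (xs ! i) \<or> B (ys ! i)"
proof -
  let ?I = "{i. i < k \<and> A (xs ! i)}" and ?J = "{i. i < k \<and> B (ys ! i)}"
  have I: "card (Collect A \<inter> set xs) = card ?I"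
    using assms distinct_length_filter[of xs A] by (simp add: length_filter_conv_card)
  have J: "card (Collect B \<inter> set ys) = card ?J"
    using assms distinct_length_filter[of ys B] by (simp add: length_filter_conv_card)
  have dis: "?I \<inter> ?J = {}" using excl by blast
  have sub: "?I \<union> ?J \<subseteq> {..<k}" by auto
  have sum: "card ?I + card ?J = card (?I \<union> ?J)"
    using dis by (intro card_Un_disjoint[symmetric]) auto
  show "card (Collect A \<inter> set xs) + card (Collect B \<inter> set ys) \<le> k"
    using I J sum card_mono[OF _ sub] by simp
  show "A (xs ! i) \<or> B (ys ! i)"
    if "card (Collect A \<inter> set xs) + card (Collect B \<inter> set ys) = k" "i < k"
  proof -
    have "?I \<union> ?J = {..<k}"
      using that I J sum sub by (intro card_subset_eq) auto
    then show ?thesis using that by blast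
  qed
qed

lemma successively_take_drop:
  assumes "successively adj P"
  shows "successively adj (take i P)" "successively adj (drop i P)"
  using assms successively_append_iff[of adj "take i P" "drop i P"] by simp_all

lemma last_take_nth: "0 < i \<Longrightarrow> i \<le> length P \<Longrightarrow> last (take i P) = P ! (i - 1)"
  by (subst last_conv_nth) (auto simp: min_def)

section \<open>Path systems\<close>

locale graph_adj =
  fixes V :: "'a set" and adj :: "'a \<Rightarrow> 'a \<Rightarrow> bool"
  assumes finV: "finite V"
    and sym: "adj x y \<Longrightarrow> adj y x"
    and irr: "\<not> adj x x"
    and adjV: "adj x y \<Longrightarrow> x \<in> V"
begin

definition nbhd :: "'a \<Rightarrow> 'a set" where "nbhd x = Collect (adj x)"

definition deg :: "'a \<Rightarrow> nat" where "deg x = card (nbhd x)"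

lemma adj_commute: "adj x y \<longleftrightarrow> adj y x"
  using sym by blast

lemma nbhd_subset: "nbhd x \<subseteq> V"
  using sym adjV by (auto simp: nbhd_def)

lemma finite_nbhd: "finite (nbhd x)"
  using finite_subset[OF nbhd_subset finV] .

lemma successively_rev_adj: "successively adj (rev C) \<longleftrightarrow> successively adj C"
  unfolding successively_rev using adj_commute by (auto intro: successively_mono)

lemma is_cycle_rev: "is_cycle adj C \<Longrightarrow> is_cycle adj (rev C)"
  using is_cycle_nonempty[of adj C]
  by (auto simp: is_cycle_def successively_rev_adj hd_rev last_rev sym simp del: successively_rev)

text \<open>
  What remains of a 2-factor of the graph with an additional edge after that edge is deleted: a path
  with the two ends of the edge, and cycles covering everything else. The ends
  turn out to be non-adjacent when there is no cycle cover (\<open>ends_nonadjacent\<close>).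
\<close>
definition path_system :: "'a list \<Rightarrow> bool" where
  "path_system P \<longleftrightarrow> 3 \<le> length P \<and> distinct P \<and> successively adj P \<and> set P \<subseteq> V
     \<and> cycle_cover adj (V - set P)"

definition rest_cycle :: "'a list \<Rightarrow> 'a list \<Rightarrow> bool" where
  "rest_cycle P C \<longleftrightarrow>
     is_cycle adj C \<and> set C \<subseteq> V - set P \<and> cycle_cover adj (V - set P - set C)"

lemma rest_cycle_rev: "rest_cycle P C \<Longrightarrow> rest_cycle P (rev C)"
  by (simp add: rest_cycle_def is_cycle_rev)

lemma rest_cycle_rotate: "rest_cycle P C \<Longrightarrow> rest_cycle P (rotate k C)"
  by (simp add: rest_cycle_def is_cycle_rotate)

lemma rest_cycle_nonempty: "rest_cycle P C \<Longrightarrow> C \<noteq> []"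
  using is_cycle_nonempty by (auto simp: rest_cycle_def)

lemma rest_cycle_hd:
  assumes "path_system P" "z \<in> V - set P"
  obtains C where "rest_cycle P C" "hd C = z"
  using cycle_cover_rotate_to[of adj "V - set P" z] assms
  unfolding path_system_def rest_cycle_def by blast

lemma rest_cycle_last:
  assumes "path_system P" "z \<in> V - set P"
  obtains C where "rest_cycle P C" "last C = z"
proof -
  obtain C where "rest_cycle P C" "hd C = z" using rest_cycle_hd[OF assms] .
  then show ?thesis
    using that[of "rev C"] rest_cycle_rev rest_cycle_nonempty by (metis last_rev)
qed

lemma path_systemD:
  assumes "path_system P"
  shows "3 \<le> length P" "P \<noteq> []" "distinct P" "successively adj P" "set P \<subseteq> V"
    "cycle_cover adj (V - set P)" "hd P = P ! 0" "last P = P ! (length P - 1)"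
    "hd P \<in> V" "last P \<in> V" "hd P \<noteq> last P"
proof -
  show 1: "3 \<le> length P" "distinct P" "successively adj P" "set P \<subseteq> V"
    "cycle_cover adj (V - set P)"
    using assms by (auto simp: path_system_def)
  show 2: "P \<noteq> []" using 1 by auto
  show 3: "hd P = P ! 0" "last P = P ! (length P - 1)"
    using 2 by (simp_all add: hd_conv_nth last_conv_nth)
  show "hd P \<in> V" "last P \<in> V" using 1 2 by auto
  show "hd P \<noteq> last P" using 1(1) 1(2) 3 nth_eq_iff_index_eq[of P 0 "length P - 1"] by force
qed

lemma path_nth_eq: "path_system P \<Longrightarrow> i < length P \<Longrightarrow> j < length P \<Longrightarrow> P ! i = P ! j \<longleftrightarrow> i = j"
  using path_systemD(3) nth_eq_iff_index_eq by blast

lemma path_adj_Suc: "path_system P \<Longrightarrow> Suc i < length P \<Longrightarrow> adj (P ! i) (P ! Suc i)"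
  using path_systemD(4) by (auto simp: successively_conv_nth)

text \<open>
  The four ways to move an end of the path: turn over an initial or a final segment, or open a cycle
  and attach it at either end.
\<close>
lemma switch_start_path:
  assumes P: "path_system P" and j: "Suc j < length P" and a: "adj (hd P) (P ! Suc j)"
  shows "path_system (rev (take (Suc j) P) @ drop (Suc j) P)"
proof -
  let ?Q = "rev (take (Suc j) P) @ drop (Suc j) P"
  have set: "set ?Q = set P"
    by (metis append_take_drop_id set_append set_rev)
  have "successively adj ?Q"
    unfolding successively_append_iff successively_rev_adj
    using a j path_systemD(2)[OF P]
    by (auto simp: successively_take_drop[OF path_systemD(4)[OF P]] last_rev hd_drop_conv_nth)
  moreover have "distinct ?Q"
    using path_systemD(3)[OF P] by (simp add: set_take_disj_set_drop_if_distinct)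
  ultimately show ?thesis using P j unfolding path_system_def set by auto
qed

lemma switch_end_path:
  assumes P: "path_system P" and i: "Suc i < length P" and a: "adj (last P) (P ! i)"
  shows "path_system (take (Suc i) P @ rev (drop (Suc i) P))"
proof -
  let ?Q = "take (Suc i) P @ rev (drop (Suc i) P)"
  have set: "set ?Q = set P"
    by (metis append_take_drop_id set_append set_rev)
  have "successively adj ?Q"
    unfolding successively_append_iff successively_rev_adj
    using sym[OF a] i path_systemD(2)[OF P]
    by (auto simp: successively_take_drop[OF path_systemD(4)[OF P]] hd_rev last_take_nth)
  moreover have "distinct ?Q"
    using path_systemD(3)[OF P] by (simp add: set_take_disj_set_drop_if_distinct)
  ultimately show ?thesis using P i unfolding path_system_def set by auto
qed

lemma switch_start_cycle:
  assumes P: "path_system P" and C: "rest_cycle P C" and a: "adj (hd P) (last C)"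
  shows "path_system (C @ P)"
proof -
  have "V - set (C @ P) = V - set P - set C" by auto
  then show ?thesis
    using P C sym[OF a] unfolding path_system_def rest_cycle_def is_cycle_def
    by (auto simp: successively_append_iff)
qed

lemma switch_end_cycle:
  assumes P: "path_system P" and C: "rest_cycle P C" and a: "adj (last P) (hd C)"
  shows "path_system (P @ C)"
proof -
  have "V - set (P @ C) = V - set P - set C" by auto
  then show ?thesis
    using P C a unfolding path_system_def rest_cycle_def is_cycle_def
    by (auto simp: successively_append_iff)
qed

end

section \<open>Sharp degree sums without a cycle cover\<close>

locale no_cover = graph_adj +
  assumes no_cover: "\<not> cycle_cover adj V"
begin

lemma cycle_not_spanning_rest:
  assumes "is_cycle adj C" "set C \<subseteq> V" "cycle_cover adj (V - set C)"
  shows False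
proof -
  have "set C \<union> (V - set C) = V" using assms by blast
  then show False using cycle_cover.insert[OF assms(3) assms(1)] no_cover by auto
qed

lemma ends_nonadjacent:
  assumes "path_system P"
  shows "\<not> adj (last P) (hd P)"
  using cycle_not_spanning_rest[of P] assms unfolding path_system_def is_cycle_def by blast

text \<open>
  Otherwise both edges together turn the path into a cycle: turn over the part behind \<open>P ! i\<close>
  and close up.
\<close>
lemma path_exclusion:
  assumes P: "path_system P" and i: "Suc i < length P"
    and a: "adj (last P) (P ! i)"
  shows "\<not> adj (hd P) (P ! Suc i)"
proof
  assume b: "adj (hd P) (P ! Suc i)"
  let ?Q = "take (Suc i) P @ rev (drop (Suc i) P)"
  have Q: "path_system ?Q" using switch_end_path[OF P i a] .
  have "hd ?Q = hd P" "last ?Q = P ! Suc i"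
    using i path_systemD(2)[OF P] by (auto simp: last_rev hd_drop_conv_nth)
  then show False using ends_nonadjacent[OF Q] b sym by auto
qed

lemma cycle_exclusion:
  assumes P: "path_system P" and C: "rest_cycle P C" and a: "adj (last P) (last C)"
  shows "\<not> adj (hd P) (hd C)"
proof
  assume b: "adj (hd P) (hd C)"
  have ne: "C \<noteq> []" "P \<noteq> []" using rest_cycle_nonempty[OF C] path_systemD[OF P] by auto
  have Q: "path_system (P @ rev C)"
    using switch_end_cycle[OF P rest_cycle_rev[OF C]] a ne by (simp add: hd_rev)
  show False using ends_nonadjacent[OF Q] b ne sym by (auto simp: last_rev)
qed

text \<open>
  The exchange without a counterpart for Hamiltonian cycles: the path is cut into two
  pieces, each of which closes up. The bounds on \<open>t\<close> guarantee that both pieces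
  have at least three vertices.
\<close>
lemma two_cycles:
  assumes P: "path_system P" and t: "2 \<le> t" "t + 4 \<le> length P"
    and a: "adj (hd P) (P ! t)" and b: "adj (last P) (P ! Suc t)"
  shows False
proof -
  let ?C = "take (Suc t) P" and ?D = "drop (Suc t) P"
  note PD = path_systemD[OF P]
  have C: "is_cycle adj ?C"
    using t a sym PD unfolding is_cycle_def
    by (auto simp: successively_take_drop last_take_nth)
  have D: "is_cycle adj ?D"
    using t b PD unfolding is_cycle_def
    by (auto simp: successively_take_drop hd_drop_conv_nth)
  have dis: "set ?C \<inter> set ?D = {}" using PD(3) by (simp add: set_take_disj_set_drop_if_distinct)
  have un: "set ?C \<union> set ?D = set P" by (metis append_take_drop_id set_append)
  have "cycle_cover adj (set ?C \<union> set ?D)"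
    using C D dis by (intro cycle_cover_Un cycle_cover_cycle)
  then have "cycle_cover adj (set P \<union> (V - set P))"
    using PD(6) un cycle_cover_Un[of adj "set P" "V - set P"] by auto
  moreover have "set P \<union> (V - set P) = V" using PD(5) by blast
  ultimately show False using no_cover by simp
qed

lemma path_count:
  assumes P: "path_system P"
  shows "card (nbhd (last P) \<inter> set P) + card (nbhd (hd P) \<inter> set P) \<le> length P - 1"
    and "card (nbhd (last P) \<inter> set P) + card (nbhd (hd P) \<inter> set P) = length P - 1
      \<Longrightarrow> Suc i < length P \<Longrightarrow> adj (last P) (P ! i) \<or> adj (hd P) (P ! Suc i)"
proof -
  note PD = path_systemD[OF P]
  let ?k = "length P - 1"
  have "set P = insert (last P) (set (butlast P))"
    using PD(2) by (metis append_butlast_last_id set_append list.set(2) list.set(1) Un_insert_right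
        sup_bot.right_neutral)
  then have 1: "Collect (adj (last P)) \<inter> set (butlast P) = nbhd (last P) \<inter> set P"
    using irr by (auto simp: nbhd_def)
  have "set P = insert (hd P) (set (tl P))"
    using PD(2) by (metis list.exhaust_sel list.set(2))
  then have 2: "Collect (adj (hd P)) \<inter> set (tl P) = nbhd (hd P) \<inter> set P"
    using irr by (auto simp: nbhd_def)
  have ex: "\<not> (adj (last P) (butlast P ! i) \<and> adj (hd P) (tl P ! i))" if "i < ?k" for i
    using path_exclusion[OF P, of i] that by (auto simp: nth_butlast nth_tl)
  note c = card_index_pair[of "butlast P" "tl P" ?k "adj (last P)" "adj (hd P)",
      OF _ _ _ _ ex, unfolded 1 2]
  show "card (nbhd (last P) \<inter> set P) + card (nbhd (hd P) \<inter> set P) \<le> ?k"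
    using c(1) PD(3) by (simp add: distinct_butlast distinct_tl)
  show "adj (last P) (P ! i) \<or> adj (hd P) (P ! Suc i)"
    if "card (nbhd (last P) \<inter> set P) + card (nbhd (hd P) \<inter> set P) = length P - 1"
      "Suc i < length P"
    using c(2)[of i] PD(3) that by (auto simp: distinct_butlast distinct_tl nth_butlast nth_tl)
qed

lemma cycle_count:
  assumes P: "path_system P" and C: "rest_cycle P C"
  shows "card (nbhd (last P) \<inter> set C) + card (nbhd (hd P) \<inter> set C) \<le> length C"
    and "card (nbhd (last P) \<inter> set C) + card (nbhd (hd P) \<inter> set C) = length C
      \<Longrightarrow> adj (last P) (last C) \<or> adj (hd P) (hd C)"
proof -
  have k: "3 \<le> length C" "distinct C" "C \<noteq> []" using C by (auto simp: rest_cycle_def is_cycle_def)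
  have ex: "\<not> (adj (last P) (C ! i) \<and> adj (hd P) (rotate1 C ! i))" if i: "i < length C" for i
  proof (cases "Suc i < length C")
    case True
    then show ?thesis
      using cycle_exclusion[OF P rest_cycle_rotate[OF C, of "Suc i"]] i
      by (simp add: rotate_hd_last nth_rotate1 del: rotate_Suc)
  next
    case False
    then have "Suc i = length C" using i by simp
    then have "i = length C - 1" "Suc i mod length C = 0" by auto
    then show ?thesis
      using cycle_exclusion[OF P C] k(3) i by (simp add: nth_rotate1 hd_conv_nth last_conv_nth)
  qed
  note c = card_index_pair[of C "rotate1 C" "length C" "adj (last P)" "adj (hd P)",
      OF _ _ _ _ ex, folded nbhd_def]
  show "card (nbhd (last P) \<inter> set C) + card (nbhd (hd P) \<inter> set C) \<le> length C"
    using c(1) k by simp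
  have "rotate1 C ! (length C - 1) = hd C" "C ! (length C - 1) = last C"
    using k by (auto simp: nth_rotate1 hd_conv_nth last_conv_nth)
  then show "adj (last P) (last C) \<or> adj (hd P) (hd C)"
    if "card (nbhd (last P) \<inter> set C) + card (nbhd (hd P) \<inter> set C) = length C"
    using c(2)[of "length C - 1"] k that by auto
qed

text \<open>
  The second cover \<open>Y\<close> carries the cycles already split off, because \<open>cycle_count\<close>
  needs a cycle whose complement in the rest is covered.
\<close>
lemma rest_count:
  assumes P: "path_system P"
  shows "cycle_cover adj Z \<Longrightarrow> cycle_cover adj Y \<Longrightarrow> Z \<union> Y = V - set P \<Longrightarrow> Z \<inter> Y = {}
    \<Longrightarrow> card (nbhd (last P) \<inter> Z) + card (nbhd (hd P) \<inter> Z) \<le> card Z"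
proof (induction arbitrary: Y rule: cycle_cover.induct)
  case empty
  then show ?case by simp
next
  case (insert Z C Y)
  have fin: "finite Z" using insert finV finite_subset[of Z V] by blast
  have CY: "cycle_cover adj (set C \<union> Y)"
    using insert by (intro cycle_cover.insert) auto
  have IH: "card (nbhd (last P) \<inter> Z) + card (nbhd (hd P) \<inter> Z) \<le> card Z"
    using insert by (intro insert.IH[OF CY]) auto
  have ZY: "cycle_cover adj (Z \<union> Y)"
    using insert by (intro cycle_cover_Un) auto
  have "V - set P - set C = Z \<union> Y" using insert by auto
  then have C: "rest_cycle P C" using insert ZY by (auto simp: rest_cycle_def)
  have len: "length C = card (set C)"
    using insert by (simp add: is_cycle_def distinct_card)
  have split: "card (N \<inter> (set C \<union> Z)) = card (N \<inter> set C) + card (N \<inter> Z)" for N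
    using insert fin by (subst card_Un_disjoint[symmetric]) (auto simp: Int_Un_distrib)
  have "card (set C \<union> Z) = card (set C) + card Z"
    using insert fin by (intro card_Un_disjoint) auto
  then show ?case using IH cycle_count(1)[OF P C] len by (simp add: split)
qed

text \<open>
  Only the estimate for \<open>Y\<close> has been used up here, so a sharp degree sum forces
  equality on the path (take \<open>X\<close> empty) and on each single cycle (take \<open>X\<close> to be that cycle).
\<close>
lemma deg_sum_split:
  assumes P: "path_system P" and cov: "cycle_cover adj X" "cycle_cover adj Y"
    and XY: "X \<union> Y = V - set P" "X \<inter> Y = {}"
  shows "deg (hd P) + deg (last P) \<le> card (nbhd (last P) \<inter> set P) + card (nbhd (hd P) \<inter> set P)
       + (card (nbhd (last P) \<inter> X) + card (nbhd (hd P) \<inter> X)) + card Y"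
    and "card V = length P + card X + card Y"
proof -
  have fin: "finite X" "finite Y" using finV XY by (auto intro: finite_subset[of _ V])
  have PV: "set P \<subseteq> V" using path_systemD[OF P] by auto
  have Y: "card (nbhd (last P) \<inter> Y) + card (nbhd (hd P) \<inter> Y) \<le> card Y"
    using rest_count[OF P cov(2,1)] XY by auto
  have split: "card N = card (N \<inter> set P) + card (N \<inter> X) + card (N \<inter> Y)" if "N \<subseteq> V" for N
  proof -
    have "N = N \<inter> set P \<union> (N \<inter> X \<union> N \<inter> Y)" using that XY by blast
    moreover have "card (N \<inter> set P \<union> (N \<inter> X \<union> N \<inter> Y)) = card (N \<inter> set P) + card (N \<inter> X \<union> N \<inter> Y)"
      using fin XY by (intro card_Un_disjoint) auto
    moreover have "card (N \<inter> X \<union> N \<inter> Y) = card (N \<inter> X) + card (N \<inter> Y)"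
      using fin XY by (intro card_Un_disjoint) auto
    ultimately show ?thesis by simp
  qed
  show "deg (hd P) + deg (last P) \<le> card (nbhd (last P) \<inter> set P) + card (nbhd (hd P) \<inter> set P)
       + (card (nbhd (last P) \<inter> X) + card (nbhd (hd P) \<inter> X)) + card Y"
    using Y split[OF nbhd_subset[of "hd P"]] split[OF nbhd_subset[of "last P"]]
    by (simp add: deg_def)
  have "V \<inter> set P = set P" "V \<inter> X = X" "V \<inter> Y = Y" using PV XY by auto
  moreover have "card (set P) = length P"
    using P by (simp add: path_system_def distinct_card)
  ultimately show "card V = length P + card X + card Y" using split[of V] by simp
qed

lemma deg_sum_path:
  assumes P: "path_system P"
  shows "deg (hd P) + deg (last P)
      \<le> card (nbhd (last P) \<inter> set P) + card (nbhd (hd P) \<inter> set P) + card (V - set P)"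
    and "card V = length P + card (V - set P)"
  using deg_sum_split[OF P cycle_cover.empty path_systemD(6)[OF P]] by simp_all

lemma deg_sum_cycle:
  assumes P: "path_system P" and C: "rest_cycle P C"
  shows "deg (hd P) + deg (last P) \<le> card (nbhd (last P) \<inter> set P) + card (nbhd (hd P) \<inter> set P)
       + (card (nbhd (last P) \<inter> set C) + card (nbhd (hd P) \<inter> set C)) + card (V - set P - set C)"
    and "card V = length P + length C + card (V - set P - set C)"
proof -
  have "cycle_cover adj (set C)" "cycle_cover adj (V - set P - set C)"
    "set C \<union> (V - set P - set C) = V - set P" "card (set C) = length C"
    using C by (auto simp: rest_cycle_def cycle_cover_cycle is_cycle_def distinct_card)
  note * = deg_sum_split[OF P this(1,2,3), unfolded this(4)]
  show "deg (hd P) + deg (last P) \<le> card (nbhd (last P) \<inter> set P) + card (nbhd (hd P) \<inter> set P)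
       + (card (nbhd (last P) \<inter> set C) + card (nbhd (hd P) \<inter> set C)) + card (V - set P - set C)"
    using *(1) by blast
  show "card V = length P + length C + card (V - set P - set C)" using *(2) by blast
qed

lemma deg_sum_less:
  assumes P: "path_system P"
  shows "deg (hd P) + deg (last P) < card V"
  using deg_sum_path[OF P] path_count(1)[OF P] path_systemD(1)[OF P] by linarith

definition tight :: "'a list \<Rightarrow> bool" where
  "tight P \<longleftrightarrow> path_system P \<and> Suc (deg (hd P) + deg (last P)) = card V"

lemma tight_path: "tight P \<Longrightarrow> path_system P"
  by (simp add: tight_def)

text \<open>
  In a tight path system the two neighbourhoods determine each other along the path, and by the next
  lemma along each cycle, in both directions.
\<close>
lemma path_dichotomy:
  assumes "tight P" and i: "Suc i < length P"
  shows "adj (last P) (P ! i) \<longleftrightarrow> \<not> adj (hd P) (P ! Suc i)"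
proof -
  have P: "path_system P" "Suc (deg (hd P) + deg (last P)) = card V"
    using assms by (auto simp: tight_def)
  have "card (nbhd (last P) \<inter> set P) + card (nbhd (hd P) \<inter> set P) = length P - 1"
    using deg_sum_path[OF P(1)] path_count(1)[OF P(1)] path_systemD(1)[OF P(1)] P(2)
    by linarith
  then show ?thesis using path_count(2)[OF P(1) _ i] path_exclusion[OF P(1) i] by blast
qed

lemma cycle_dichotomy:
  assumes "tight P" and C: "rest_cycle P C"
  shows "adj (last P) (last C) \<longleftrightarrow> \<not> adj (hd P) (hd C)"
proof -
  have P: "path_system P" "Suc (deg (hd P) + deg (last P)) = card V"
    using assms by (auto simp: tight_def)
  have "card (nbhd (last P) \<inter> set C) + card (nbhd (hd P) \<inter> set C) = length C"
    using deg_sum_cycle[OF P(1) C] path_count(1)[OF P(1)] path_systemD(1)[OF P(1)] P(2)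
      cycle_count(1)[OF P(1) C] by linarith
  then show ?thesis using cycle_count(2)[OF P(1) C] cycle_exclusion[OF P(1) C] by blast
qed

lemma cycle_dichotomy_rev:
  assumes "tight P" and C: "rest_cycle P C"
  shows "adj (last P) (hd C) \<longleftrightarrow> \<not> adj (hd P) (last C)"
  using cycle_dichotomy[OF assms(1) rest_cycle_rev[OF C]] rest_cycle_nonempty[OF C]
  by (simp add: hd_rev last_rev)

section \<open>The trapped penultimate vertex\<close>

text \<open>
  If \<open>P ! i\<close> is missed by the last vertex, then the first vertex sees \<open>P ! (i + 1)\<close>; if the
  last vertex saw \<open>P ! (i + 2)\<close>, the path would split into two cycles.
\<close>
lemma path_propagate:
  assumes T: "tight P" and i: "1 \<le> i" "i + 5 \<le> length P" and n: "\<not> adj (last P) (P ! i)"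
  shows "\<not> adj (last P) (P ! (i + 2))"
proof
  assume "adj (last P) (P ! (i + 2))"
  moreover have "adj (hd P) (P ! Suc i)" using path_dichotomy[OF T, of i] i n by auto
  ultimately show False using two_cycles[OF tight_path[OF T], of "Suc i"] i by auto
qed

lemma penultimate:
  assumes T: "tight P"
  shows "adj (last P) (P ! (length P - 2))" "\<not> adj (hd P) (P ! (length P - 1))"
proof -
  note PD = path_systemD[OF tight_path[OF T]]
  show "\<not> adj (hd P) (P ! (length P - 1))"
    using ends_nonadjacent[OF tight_path[OF T]] PD(8) sym by metis
  have "Suc (length P - 2) = length P - 1" using PD(1) by simp
  then show "adj (last P) (P ! (length P - 2))"
    using path_adj_Suc[OF tight_path[OF T], of "length P - 2"] PD(1,8) sym by auto
qed

lemma cover_extend: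
  assumes C: "is_cycle adj C" "set C \<subseteq> Y" "cycle_cover adj (Y - set C)"
    and R: "R \<noteq> []" "distinct R" "successively adj R" "set R \<inter> Y = {}"
    and ends: "adj (last C) (hd R)" "adj (last R) (hd C)"
  shows "cycle_cover adj (Y \<union> set R)"
proof -
  have "is_cycle adj (C @ R)"
    using C R ends is_cycle_nonempty[OF C(1)] by (auto simp: is_cycle_def successively_append_iff)
  moreover have "set (C @ R) \<inter> (Y - set C) = {}" using R by auto
  ultimately have "cycle_cover adj (set (C @ R) \<union> (Y - set C))"
    using C by (intro cycle_cover.insert)
  moreover have "set (C @ R) \<union> (Y - set C) = Y \<union> set R" using C by auto
  ultimately show ?thesis by simp
qed

text \<open>
  This is what is needed for inserting a piece of the path that contains \<open>last P\<close> into a cover of \<open>Y\<close>: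
  the piece goes between \<open>last C\<close> and \<open>y\<close>, provided that its other end is adjacent to \<open>y\<close>.
\<close>
definition entry_ready :: "'a list \<Rightarrow> 'a set \<Rightarrow> bool" where
  "entry_ready P Y \<longleftrightarrow> (\<forall>y\<in>Y. y \<noteq> hd P \<longrightarrow> \<not> adj (hd P) y \<longrightarrow>
     (\<exists>C. is_cycle adj C \<and> hd C = y \<and> adj (last P) (last C) \<and> set C \<subseteq> Y
        \<and> cycle_cover adj (Y - set C)))"

lemma entry_readyI:
  assumes T: "tight P" and B: "is_cycle adj B" "set B \<inter> Z = {}"
    and Z: "Z \<subseteq> V - set P" "cycle_cover adj Z" "cycle_cover adj (V - set P - Z)"
    and pred: "\<And>i. i < length B \<Longrightarrow> B ! i \<noteq> hd P \<Longrightarrow> \<not> adj (hd P) (B ! i)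
        \<Longrightarrow> 0 < i \<and> adj (last P) (B ! (i - 1))"
  shows "entry_ready P (set B \<union> Z)"
  unfolding entry_ready_def
proof (intro ballI impI)
  fix y assume y: "y \<in> set B \<union> Z" "y \<noteq> hd P" "\<not> adj (hd P) y"
  show "\<exists>C. is_cycle adj C \<and> hd C = y \<and> adj (last P) (last C) \<and> set C \<subseteq> set B \<union> Z
        \<and> cycle_cover adj (set B \<union> Z - set C)"
  proof (cases "y \<in> set B")
    case True
    then obtain i where i: "i < length B" "B ! i = y" by (auto simp: in_set_conv_nth)
    then have p: "0 < i" "adj (last P) (B ! (i - 1))" using pred[of i] y by auto
    have "set B \<union> Z - set B = Z" using B by auto
    then show ?thesis
      using is_cycle_rotate[OF B(1), of i] rotate_hd_last[OF i(1) p(1)] p i Z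
      by (intro exI[of _ "rotate i B"]) auto
  next
    case False
    then have "y \<in> Z" using y by auto
    then obtain C where C: "is_cycle adj C" "hd C = y" "set C \<subseteq> Z" "cycle_cover adj (Z - set C)"
      using cycle_cover_rotate_to[OF Z(2)] by blast
    have "cycle_cover adj ((V - set P - Z) \<union> (Z - set C))"
      using Z C by (intro cycle_cover_Un) auto
    moreover have "(V - set P - Z) \<union> (Z - set C) = V - set P - set C" using C Z by auto
    ultimately have "rest_cycle P C" using C Z by (auto simp: rest_cycle_def)
    then have "adj (last P) (last C)" using cycle_dichotomy[OF T] y C by auto
    moreover have "cycle_cover adj (set B \<union> (Z - set C))"
      using B C by (intro cycle_cover.insert) auto
    moreover have "set B \<union> (Z - set C) = set B \<union> Z - set C" using B C by auto
    ultimately show ?thesis using C by (intro exI[of _ C]) auto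
  qed
qed

lemma tight_deg_last: "tight P \<Longrightarrow> deg (last P) = card V - 1 - deg (hd P)"
  by (auto simp: tight_def)

text \<open>
  The last vertex has more neighbours than the first one, so there is a place to insert it.
\<close>
lemma absorb_last:
  assumes T: "tight P" and n: "2 * deg (hd P) + 3 \<le> card V"
    and Y: "entry_ready P Y" "Y = V - {last P}"
  shows False
proof -
  note PD = path_systemD[OF tight_path[OF T]]
  have "card (nbhd (hd P)) < card (nbhd (last P))"
    using tight_deg_last[OF T] n by (auto simp: deg_def)
  then have "\<not> nbhd (last P) \<subseteq> nbhd (hd P)" using card_mono[OF finite_nbhd] by (meson not_le)
  then obtain y where y: "adj (last P) y" "\<not> adj (hd P) y" by (auto simp: nbhd_def)
  have yV: "y \<in> Y" using y irr sym adjV Y(2) by blast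
  have "y \<noteq> hd P" using y ends_nonadjacent[OF tight_path[OF T]] by auto
  then obtain C where C: "is_cycle adj C" "hd C = y" "adj (last P) (last C)" "set C \<subseteq> Y"
     "cycle_cover adj (Y - set C)"
    using Y y yV unfolding entry_ready_def by blast
  have "cycle_cover adj (Y \<union> set [last P])"
    using C Y y sym by (intro cover_extend[of C]) auto
  moreover have "Y \<union> set [last P] = V" using Y PD by auto
  ultimately show False using no_cover by simp
qed

lemma absorb_last_two:
  assumes T: "tight P" and m: "adj m (last P)" "\<not> adj (hd P) m"
    and Y: "entry_ready P Y" "Y = V - {m, last P}"
  shows "nbhd m \<subseteq> insert (last P) (nbhd (hd P))"
proof
  fix y assume "y \<in> nbhd m"
  then have y: "adj m y" by (simp add: nbhd_def)
  show "y \<in> insert (last P) (nbhd (hd P))"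
  proof (rule ccontr)
    assume "y \<notin> insert (last P) (nbhd (hd P))"
    then have n: "y \<noteq> last P" "\<not> adj (hd P) y" by (auto simp: nbhd_def)
    have yV: "y \<in> Y" "y \<noteq> hd P" using y n irr sym adjV Y(2) m by blast+
    then obtain C where C: "is_cycle adj C" "hd C = y" "adj (last P) (last C)" "set C \<subseteq> Y"
       "cycle_cover adj (Y - set C)"
      using Y n yV unfolding entry_ready_def by blast
    have "cycle_cover adj (Y \<union> set [last P, m])"
      using C Y y m sym irr by (intro cover_extend[of C]) auto
    moreover have "Y \<union> set [last P, m] = V"
      using Y path_systemD[OF tight_path[OF T]] adjV[OF m(1)] by auto
    ultimately show False using no_cover by simp
  qed
qed

definition missed :: "'a list \<Rightarrow> 'a set" where
  "missed P = V - insert (last P) (nbhd (last P))"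

lemma switch_start_path_nth:
  assumes "Suc j < length P"
  shows "hd (rev (take (Suc j) P) @ drop (Suc j) P) = P ! j"
    "last (rev (take (Suc j) P) @ drop (Suc j) P) = last P"
    "i \<le> j \<Longrightarrow> (rev (take (Suc j) P) @ drop (Suc j) P) ! i = P ! (j - i)"
    "j < i \<Longrightarrow> i < length P \<Longrightarrow> (rev (take (Suc j) P) @ drop (Suc j) P) ! i = P ! i"
proof -
  have "P \<noteq> []" using assms by auto
  then show "hd (rev (take (Suc j) P) @ drop (Suc j) P) = P ! j"
    "last (rev (take (Suc j) P) @ drop (Suc j) P) = last P"
    using assms by (auto simp: hd_append hd_rev last_take_nth)
  show "i \<le> j \<Longrightarrow> (rev (take (Suc j) P) @ drop (Suc j) P) ! i = P ! (j - i)"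
    "j < i \<Longrightarrow> i < length P \<Longrightarrow> (rev (take (Suc j) P) @ drop (Suc j) P) ! i = P ! i"
    using assms by (auto simp: nth_append rev_nth)
qed

lemma missed_on_path:
  assumes T: "tight P" and l: "l \<in> missed P" "l \<in> set P"
  obtains j where "Suc j < length P" "P ! j = l" "\<not> adj (last P) (P ! j)"
    "adj (hd P) (P ! Suc j)" "j + 3 \<le> length P"
proof -
  note PD = path_systemD[OF tight_path[OF T]]
  obtain j where j: "j < length P" "P ! j = l" using l by (auto simp: in_set_conv_nth)
  have n: "\<not> adj (last P) l" "l \<noteq> last P" using l by (auto simp: missed_def nbhd_def)
  then have "j \<noteq> length P - 1" "j \<noteq> length P - 2" using j PD(8) penultimate[OF T] by auto
  then have "Suc j < length P" "j + 3 \<le> length P" using j by auto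
  then show ?thesis using that j n path_dichotomy[OF T, of j] by auto
qed

text \<open>
  If the second vertex \<open>P ! 1\<close> has a missed neighbour \<open>l\<close> besides \<open>hd P\<close>, the piece formed by
  \<open>P ! 1\<close> and \<open>hd P\<close> can be inserted between \<open>l\<close> and the successor of \<open>l\<close>, which the first
  vertex sees. The rest of the path, from \<open>P ! 2\<close> on, closes up.
\<close>
lemma spare_edge_short:
  assumes T: "tight P" and p: "5 \<le> length P" and x2: "adj (last P) (P ! 2)"
    and l: "l \<in> missed P" "l \<noteq> hd P" "adj l (P ! 1)"
  shows False
proof (cases "l \<in> set P")
  case True
  note PD = path_systemD[OF tight_path[OF T]]
  obtain j where j: "Suc j < length P" "P ! j = l" "\<not> adj (last P) (P ! j)"
      "adj (hd P) (P ! Suc j)"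
    using missed_on_path[OF T l(1) True] by metis
  have "j \<noteq> 0"
  proof
    assume "j = 0"
    then show False using l j(2) PD(7) by simp
  qed
  moreover have "j \<noteq> 1" "j \<noteq> 2" using j l(3) x2 irr by auto
  ultimately have j3: "3 \<le> j" by simp
  let ?Q = "rev (take (Suc j) P) @ drop (Suc j) P"
  note Q = switch_start_path[OF tight_path[OF T] j(1,4)] and Qn = switch_start_path_nth[OF j(1)]
  \<comment> \<open>In \<open>?Q\<close> the vertices run \<open>l, \<dots>, P ! 2, P ! 1, hd P\<close>; turning over the part in front of \<open>P ! 1\<close> makes \<open>P ! 2\<close> the first vertex.\<close>
  have "?Q ! Suc (j - 2) = P ! 1" "Suc (j - 2) < length ?Q" using Qn(3)[of "Suc (j - 2)"] j j3 by auto
  then have R: "path_system (rev (take (Suc (j - 2)) ?Q) @ drop (Suc (j - 2)) ?Q)"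
    and Rl: "Suc (j - 2) < length ?Q"
    using switch_start_path[OF Q, of "j - 2"] l(3) j(2) Qn(1) by auto
  have "?Q ! (j - 2) = P ! 2" using Qn(3)[of "j - 2"] j3 by simp
  then show False
    using ends_nonadjacent[OF R] switch_start_path_nth(1,2)[OF Rl] Qn(2) x2 by simp
next
  case False
  note PD = path_systemD[OF tight_path[OF T]]
  obtain C where C: "rest_cycle P C" "last C = l"
    using rest_cycle_last[OF tight_path[OF T]] False l by (auto simp: missed_def)
  have ne: "C \<noteq> []" "3 \<le> length C" using C by (auto simp: rest_cycle_def is_cycle_def)
  have "adj (hd P) (hd C)" using cycle_dichotomy[OF T C(1)] C(2) l by (auto simp: missed_def nbhd_def)
  then have Q: "path_system (rev C @ P)"
    using switch_start_cycle[OF tight_path[OF T] rest_cycle_rev[OF C(1)]] ne by (simp add: last_rev)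
  show False
    using two_cycles[OF Q, of "Suc (length C)"] p ne l C x2 PD(2)
    by (auto simp: nth_append hd_rev numeral_2_eq_2)
qed

text \<open>
  Propagation is most useful for the missed vertex nearest to the end of the path. By the final
  clause it is an inner vertex as soon as some inner vertex is missed.
\<close>
lemma last_missed:
  assumes T: "tight P"
  obtains s where "s + 3 \<le> length P" "\<not> adj (last P) (P ! s)"
    "\<And>i. s < i \<Longrightarrow> Suc i < length P \<Longrightarrow> adj (last P) (P ! i)"
    "\<And>i. 1 \<le> i \<Longrightarrow> Suc i < length P \<Longrightarrow> \<not> adj (last P) (P ! i) \<Longrightarrow> 1 \<le> s"
proof -
  note PD = path_systemD[OF tight_path[OF T]]
  let ?S = "{i. Suc i < length P \<and> \<not> adj (last P) (P ! i)}"
  have fin: "finite ?S" by (rule finite_subset[of _ "{..<length P}"]) auto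
  have "0 \<in> ?S" using ends_nonadjacent[OF tight_path[OF T]] PD(1,7) by auto
  then have ne: "?S \<noteq> {}" by blast
  have s: "Max ?S \<in> ?S" using Max_in[OF fin ne] .
  have "Max ?S \<noteq> length P - 2" using s penultimate(1)[OF T] by auto
  moreover have "Suc (Max ?S) < length P" using s by blast
  ultimately have "Max ?S + 3 \<le> length P" by linarith
  moreover have "adj (last P) (P ! i)" if "Max ?S < i" "Suc i < length P" for i
    using that Max_ge[OF fin, of i] by auto
  moreover have "1 \<le> Max ?S" if "1 \<le> i" "Suc i < length P" "\<not> adj (last P) (P ! i)" for i
    using that Max_ge[OF fin, of i] by auto
  ultimately show ?thesis using that s by blast
qed

text \<open>
  By propagation, the last missed vertex \<open>P ! s\<close> is the third or fourth vertex from the end. The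
  initial segment up to the successor of \<open>P ! s\<close> closes up to a cycle, which leaves
  one or two vertices to be inserted elsewhere. A single vertex can always be inserted; two
  can be inserted unless the neighbours of the penultimate vertex are confined as stated.
\<close>
lemma trapped_penultimate_interior:
  assumes T: "tight P" and n: "2 * deg (hd P) + 3 \<le> card V"
    and i: "1 \<le> i" "Suc i < length P" "\<not> adj (last P) (P ! i)"
  shows "5 \<le> length P \<and> \<not> adj (last P) (P ! (length P - 4))
    \<and> \<not> adj (hd P) (P ! (length P - 2))
    \<and> nbhd (P ! (length P - 2)) \<subseteq> insert (last P) (nbhd (hd P))"
proof -
  note PD = path_systemD[OF tight_path[OF T]]
  obtain s where s: "s + 3 \<le> length P" "\<not> adj (last P) (P ! s)"
    "\<And>i. s < i \<Longrightarrow> Suc i < length P \<Longrightarrow> adj (last P) (P ! i)" "1 \<le> s"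
    using last_missed[OF T] i by metis
  have "\<not> s + 5 \<le> length P" using path_propagate[OF T s(4) _ s(2)] s(3)[of "s + 2"] by auto
  then have cases: "length P = s + 3 \<or> length P = s + 4" using s by linarith
  have us: "adj (hd P) (P ! Suc s)" using path_dichotomy[OF T, of s] s by auto
  let ?B = "take (s + 2) P"
  have B: "is_cycle adj ?B"
    using PD s us sym by (auto simp: is_cycle_def successively_take_drop last_take_nth)
  have pred: "0 < i \<and> adj (last P) (?B ! (i - 1))"
    if "i < length ?B" "?B ! i \<noteq> hd P" "\<not> adj (hd P) (?B ! i)" for i
  proof -
    have "i \<noteq> 0" using that PD(7) s by (cases "i = 0") auto
    then show ?thesis using that path_dichotomy[OF T, of "i - 1"] by auto
  qed
  have BP: "set ?B \<subseteq> set P" by (rule set_take_subset)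
  have ready: "entry_ready P (set ?B \<union> (V - set P))"
    using BP PD cycle_cover.empty by (intro entry_readyI[OF T B _ _ _ _ pred]) auto
  have dis: "set ?B \<inter> set (drop (s + 2) P) = {}"
    using PD(3) by (simp add: set_take_disj_set_drop_if_distinct)
  have sP: "set P = set ?B \<union> set (drop (s + 2) P)"
    by (metis append_take_drop_id set_append)
  show ?thesis
    using cases
  proof
    assume p: "length P = s + 3"
    then have "drop (s + 2) P = [last P]"
      using PD(8) Cons_nth_drop_Suc[of "s + 2" P] by (simp add: numeral_eq_Suc)
    then have "set ?B \<union> (V - set P) = V - {last P}" using dis sP PD(5) by auto
    then show ?thesis using absorb_last[OF T n ready] by blast
  next
    assume p: "length P = s + 4"
    then have "drop (s + 2) P = [P ! (s + 2), last P]"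
      using PD(8) Cons_nth_drop_Suc[of "s + 2" P] Cons_nth_drop_Suc[of "s + 3" P]
      by (simp add: numeral_eq_Suc)
    then have Y: "set ?B \<union> (V - set P) = V - {P ! (s + 2), last P}" using dis sP PD(5) by auto
    have "adj (last P) (P ! Suc s)" using s(3)[of "Suc s"] p by auto
    then have m: "\<not> adj (hd P) (P ! (s + 2))" using path_dichotomy[OF T, of "Suc s"] p by auto
    have "adj (P ! (s + 2)) (last P)" using penultimate(1)[OF T] p sym by auto
    then show ?thesis using absorb_last_two[OF T _ m ready Y] p m s(2,4) by auto
  qed
qed

text \<open>
  The same conclusion when all inner vertices of the path are seen by the last vertex. Now the cycle
  to start from is the one through \<open>l\<close>, enlarged by the first two vertices of the path.
\<close>
lemma trapped_penultimate_spare_aux: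
  assumes T: "tight P" and n: "2 * deg (hd P) + 3 \<le> card V"
    and no: "\<And>i. 1 \<le> i \<Longrightarrow> Suc i < length P \<Longrightarrow> adj (last P) (P ! i)"
    and l: "l \<in> missed P" "l \<noteq> hd P" "adj l (P ! 1)"
  shows "4 \<le> length P \<and> \<not> adj (hd P) (P ! (length P - 2))
    \<and> nbhd (P ! (length P - 2)) \<subseteq> insert (last P) (nbhd (hd P))"
proof -
  note PD = path_systemD[OF tight_path[OF T]]
  have "\<not> 5 \<le> length P" using spare_edge_short[OF T _ _ l] no[of 2] by auto
  then have cases: "length P = 3 \<or> length P = 4" using PD(1) by linarith
  have "l \<notin> set P"
  proof
    assume "l \<in> set P"
    then obtain j where "Suc j < length P" "P ! j = l" "\<not> adj (last P) (P ! j)"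
      using missed_on_path[OF T l(1)] by metis
    then show False using no[of j] l(2) PD(7) by (cases j) auto
  qed
  then obtain C where C: "rest_cycle P C" "last C = l"
    using rest_cycle_last[OF tight_path[OF T]] l by (auto simp: missed_def)
  have Cc: "is_cycle adj C" "set C \<subseteq> V - set P" "cycle_cover adj (V - set P - set C)"
    using C by (auto simp: rest_cycle_def)
  have ne: "C \<noteq> []" "3 \<le> length C" using Cc by (auto simp: is_cycle_def)
  have uC: "adj (hd P) (hd C)" using cycle_dichotomy[OF T C(1)] C(2) l by (auto simp: missed_def nbhd_def)
  have x01: "adj (hd P) (P ! 1)" using path_adj_Suc[OF tight_path[OF T], of 0] PD by auto
  let ?B = "C @ [P ! 1, hd P]"
  have P01: "P ! 1 \<in> set P" "hd P \<in> set P" "P ! 1 \<noteq> hd P"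
    using PD path_nth_eq[OF tight_path[OF T], of 1 0] by auto
  have B: "is_cycle adj ?B"
    using Cc ne uC x01 sym l C P01 by (auto simp: is_cycle_def successively_append_iff)
  let ?Z = "V - set P - set C"
  have pred: "0 < i \<and> adj (last P) (?B ! (i - 1))"
    if "i < length ?B" "?B ! i \<noteq> hd P" "\<not> adj (hd P) (?B ! i)" for i
  proof -
    have i: "i < length C" using that x01 by (auto simp: nth_append nth_Cons' less_Suc_eq split: if_splits)
    moreover have "i \<noteq> 0" using that(3) uC ne by (cases "i = 0") (auto simp: nth_append hd_conv_nth)
    ultimately show ?thesis
      using that cycle_dichotomy[OF T rest_cycle_rotate[OF C(1), of i]] rotate_hd_last[of i C]
      by (auto simp: nth_append)
  qed
  have "V - set P - ?Z = set C" using Cc by auto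
  then have ready: "entry_ready P (set ?B \<union> ?Z)"
    using P01 Cc by (intro entry_readyI[OF T B _ _ _ _ pred]) (auto intro: cycle_cover_cycle)
  have "take 2 P = [hd P, P ! 1]"
    using PD(1,7) by (cases P; cases "tl P") auto
  moreover have "set (take 2 P) \<inter> set (drop 2 P) = {}" "set P = set (take 2 P) \<union> set (drop 2 P)"
    using PD(3) by (simp add: set_take_disj_set_drop_if_distinct) (metis append_take_drop_id set_append)
  ultimately have sP: "set P = {hd P, P ! 1} \<union> set (drop 2 P)" "{hd P, P ! 1} \<inter> set (drop 2 P) = {}"
    by auto
  show ?thesis
    using cases
  proof
    assume p: "length P = 3"
    then have "drop 2 P = [last P]"
      using PD(8) Cons_nth_drop_Suc[of 2 P] by (simp add: numeral_eq_Suc)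
    then have "set ?B \<union> ?Z = V - {last P}" using sP PD(5) Cc by auto
    then show ?thesis using absorb_last[OF T n ready] by blast
  next
    assume p: "length P = 4"
    then have "drop 2 P = [P ! 2, last P]"
      using PD(8) Cons_nth_drop_Suc[of 2 P] Cons_nth_drop_Suc[of 3 P] by (simp add: numeral_eq_Suc)
    then have Y: "set ?B \<union> ?Z = V - {P ! 2, last P}" using sP PD(5) Cc by auto
    have "adj (last P) (P ! 1)" using no[of 1] p by auto
    then have m: "\<not> adj (hd P) (P ! 2)" using path_dichotomy[OF T, of 1] p by (auto simp: numeral_2_eq_2)
    have "adj (P ! 2) (last P)" using penultimate(1)[OF T] p sym by auto
    then show ?thesis using absorb_last_two[OF T _ m ready Y] p m by auto
  qed
qed

lemma trapped_penultimate_spare: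
  assumes T: "tight P" and n: "2 * deg (hd P) + 3 \<le> card V"
    and l: "l \<in> missed P" "l \<noteq> hd P" "adj l (P ! 1)"
  shows "4 \<le> length P \<and> \<not> adj (hd P) (P ! (length P - 2))
    \<and> nbhd (P ! (length P - 2)) \<subseteq> insert (last P) (nbhd (hd P))"
proof (cases "\<exists>i. 1 \<le> i \<and> Suc i < length P \<and> \<not> adj (last P) (P ! i)")
  case True
  then obtain i where "1 \<le> i" "Suc i < length P" "\<not> adj (last P) (P ! i)" by blast
  from trapped_penultimate_interior[OF T n this] show ?thesis by simp
next
  case False
  then show ?thesis by (intro trapped_penultimate_spare_aux[OF T n _ l]) blast
qed

text \<open>
  A vertex \<open>w\<close> outside the path that can replace the last vertex without changing degrees
  inherits the adjacency to the penultimate vertex: attach the cycle through \<open>w\<close> at the end and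
  apply the dichotomy to the longer path, where the old last vertex follows the penultimate one.
\<close>
lemma outside_end_adj:
  assumes T: "tight P" and p: "4 \<le> length P"
    and w: "w \<in> V" "w \<notin> set P" "deg w = deg (last P)" "\<not> adj (hd P) w"
  shows "adj w (P ! (length P - 2))"
proof -
  note PD = path_systemD[OF tight_path[OF T]]
  obtain C where C: "rest_cycle P C" "last C = w"
    using rest_cycle_last[OF tight_path[OF T]] w by blast
  have ne: "C \<noteq> []" using rest_cycle_nonempty[OF C(1)] .
  have "adj (last P) (hd C)" using cycle_dichotomy_rev[OF T C(1)] C w by auto
  then have Q: "path_system (P @ C)" by (rule switch_end_cycle[OF tight_path[OF T] C(1)])
  then have TQ: "tight (P @ C)" using T ne PD(2) C w(3) by (simp add: tight_def)
  have i: "Suc (length P - 2) = length P - 1" using p by simp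
  show ?thesis
    using path_dichotomy[OF TQ, of "length P - 2"] p ne PD(2) C(2) i penultimate(2)[OF T]
    by (simp add: nth_append)
qed

text \<open>
  Two consecutive seen vertices behind a missed inner vertex are impossible, since
  propagation in steps of two hits one of them.
\<close>
lemma no_gap_after:
  assumes T: "tight P" and ab: "1 \<le> a" "a \<le> b" "b + 3 \<le> length P"
    and a: "\<not> adj (last P) (P ! a)" and b: "adj (last P) (P ! b)" "adj (last P) (P ! (b - 1))"
  shows False
proof -
  have *: "\<not> adj (last P) (P ! (a + 2 * k))" if "a + 2 * k + 3 \<le> length P" for k
    using that
  proof (induction k)
    case 0
    then show ?case using a by simp
  next
    case (Suc k)
    then show ?case using path_propagate[OF T, of "a + 2 * k"] ab by auto
  qed
  show False
  proof (cases "even (b - a)")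
    case True
    then obtain k where "b - a = 2 * k" by blast
    then have "b = a + 2 * k" using ab by simp
    then show ?thesis using *[of k] ab b by auto
  next
    case False
    then obtain k where "b - a = 2 * k + 1" using oddE by blast
    then have "b - 1 = a + 2 * k" "b = a + 2 * k + 1" using ab by auto
    then show ?thesis using *[of k] ab b by auto
  qed
qed

lemma deg_less: "x \<in> V \<Longrightarrow> deg x < card V"
  using psubset_card_mono[OF finV, of "nbhd x"] nbhd_subset irr
  by (auto simp: deg_def nbhd_def)

lemma missed_card: "tight P \<Longrightarrow> card (missed P) = deg (hd P)"
proof -
  assume T: "tight P"
  note PD = path_systemD[OF tight_path[OF T]]
  have "card (insert (last P) (nbhd (last P))) = Suc (deg (last P))"
    using irr finite_nbhd by (auto simp: deg_def nbhd_def)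
  then have "card (missed P) = card V - Suc (deg (last P))"
    unfolding missed_def using PD nbhd_subset finite_nbhd by (subst card_Diff_subset) auto
  then show ?thesis using T by (auto simp: tight_def)
qed

lemma tight_switch_start_cycle:
  assumes T: "tight P" and l: "l \<in> missed P" "l \<notin> set P" "deg l = deg (hd P)"
  obtains C where "tight (C @ P)" "hd (C @ P) = l" "last (C @ P) = last P" "1 \<le> length C"
proof -
  note PD = path_systemD[OF tight_path[OF T]]
  obtain C where C: "rest_cycle P C" "hd C = l"
    using rest_cycle_hd[OF tight_path[OF T]] l by (auto simp: missed_def)
  have ne: "C \<noteq> []" using rest_cycle_nonempty[OF C(1)] .
  have "adj (hd P) (last C)"
    using cycle_dichotomy_rev[OF T C(1)] C(2) l by (auto simp: missed_def nbhd_def)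
  then have "path_system (C @ P)" by (rule switch_start_cycle[OF tight_path[OF T] C(1)])
  then have "tight (C @ P)" using T l C ne PD(2) by (simp add: tight_def)
  then show ?thesis using that[of C] C ne PD(2) by (cases C) auto
qed

text \<open>
  A second missed vertex of the same degree as the first vertex makes it possible to assume that an inner
  vertex is missed: if it lies on a cycle, open that cycle there, whereby the former
  first vertex becomes an inner vertex.
\<close>
lemma exists_interior_missed:
  assumes T: "tight P" and l: "l \<in> missed P" "l \<noteq> hd P" "deg l = deg (hd P)"
  obtains Q i where "tight Q" "deg (hd Q) = deg (hd P)" "last Q = last P"
    "1 \<le> i" "Suc i < length Q" "\<not> adj (last Q) (Q ! i)"
proof (cases "l \<in> set P")
  case True
  then obtain j where j: "Suc j < length P" "P ! j = l" "\<not> adj (last P) (P ! j)"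
    using missed_on_path[OF T l(1)] by metis
  moreover have "j \<noteq> 0" using j l path_systemD(7)[OF tight_path[OF T]] by metis
  ultimately show ?thesis using that[of P j] T by auto
next
  case False
  note PD = path_systemD[OF tight_path[OF T]]
  obtain C where C: "tight (C @ P)" "hd (C @ P) = l" "last (C @ P) = last P" "1 \<le> length C"
    using tight_switch_start_cycle[OF T l(1) False l(3)] by metis
  have "\<not> adj (last P) ((C @ P) ! length C)"
    using ends_nonadjacent[OF tight_path[OF T]] PD(1,7) by (auto simp: nth_append)
  then show ?thesis using that[of "C @ P" "length C"] C l(3) PD(1) by auto
qed

end

section \<open>Edge-maximal graphs without a cycle cover\<close>

text \<open>
  Edge-maximality enters only through the path systems that it provides, see
  \<open>path_system_of_added_edge\<close>.
\<close>
locale saturated = no_cover +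
  assumes sat: "u \<in> V \<Longrightarrow> v \<in> V \<Longrightarrow> u \<noteq> v \<Longrightarrow> \<not> adj u v
      \<Longrightarrow> \<exists>P. path_system P \<and> hd P = u \<and> last P = v"
begin

definition low_count :: "nat \<Rightarrow> nat" where "low_count k = card {x \<in> V. deg x \<le> k}"

lemma nonadj_deg_sum:
  assumes "u \<in> V" "v \<in> V" "u \<noteq> v" "\<not> adj u v"
  shows "deg u + deg v < card V"
  using sat[OF assms] deg_sum_less by blast

lemma adj_if_deg_sum:
  "u \<in> V \<Longrightarrow> v \<in> V \<Longrightarrow> u \<noteq> v \<Longrightarrow> card V \<le> deg u + deg v \<Longrightarrow> adj u v"
  using nonadj_deg_sum by (meson not_le)

lemma missed_deg: "tight P \<Longrightarrow> l \<in> missed P \<Longrightarrow> deg l \<le> deg (hd P)"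
proof -
  assume T: "tight P" and l: "l \<in> missed P"
  note PD = path_systemD[OF tight_path[OF T]]
  have "deg l + deg (last P) < card V"
    using l PD sym by (intro nonadj_deg_sum) (auto simp: missed_def nbhd_def)
  then show ?thesis using T by (auto simp: tight_def)
qed

lemma missedI: "x \<in> V \<Longrightarrow> x \<noteq> last P \<Longrightarrow> \<not> adj x (last P) \<Longrightarrow> x \<in> missed P"
  using sym by (auto simp: missed_def nbhd_def)

lemma card_high:
  "card {x \<in> V. k < deg x} = card V - low_count k"
proof -
  have "{x \<in> V. k < deg x} = V - {x \<in> V. deg x \<le> k}" by auto
  then show ?thesis using finV by (simp add: low_count_def card_Diff_subset)
qed

text \<open>
  Each vertex of degree above \<open>k\<close> is adjacent to \<open>u\<close> by the degree-sum bound, and the bound on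
  \<open>low_count\<close> says that there are at least \<open>deg u\<close> of them.
\<close>
lemma high_is_nbhd:
  assumes u: "u \<in> V" "2 * deg u + 3 \<le> card V" and k: "card V \<le> deg u + Suc k"
    and c: "low_count k \<le> card V - deg u"
  shows "nbhd u = {x \<in> V. k < deg x}"
proof -
  have ne: "x \<noteq> u" if "k < deg x" for x using that u k by auto
  have sub: "{x \<in> V. k < deg x} \<subseteq> nbhd u"
  proof
    fix x assume x: "x \<in> {x \<in> V. k < deg x}"
    then have "adj u x" using u k ne[of x] by (intro adj_if_deg_sum) auto
    then show "x \<in> nbhd u" by (simp add: nbhd_def)
  qed
  moreover have "deg u \<le> card V - low_count k" using c u by linarith
  then have "card (nbhd u) \<le> card {x \<in> V. k < deg x}"
    by (simp only: card_high deg_def[of u, symmetric])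
  ultimately show ?thesis using card_seteq[OF finite_nbhd sub] by simp
qed

text \<open>
  Here the second vertex of the path is one of the vertices of very large degree and
  has fewer non-neighbours than there are missed vertices besides the first one.
\<close>
lemma spare_edge_of_high:
  assumes T: "tight P" and n: "2 * deg (hd P) + 3 \<le> card V"
    and c: "low_count (card V - deg (hd P)) \<le> card V - deg (hd P)"
  obtains l where "l \<in> missed P" "l \<noteq> hd P" "adj l (P ! 1)"
proof -
  note PD = path_systemD[OF tight_path[OF T]]
  let ?h = "deg (hd P)" and ?x = "P ! 1"
  have N: "nbhd (hd P) = {x \<in> V. card V - ?h < deg x}"
    using high_is_nbhd[OF PD(9) n _ c] by simp
  have "?x \<in> nbhd (hd P)"
    using path_adj_Suc[OF tight_path[OF T], of 0] PD by (auto simp: nbhd_def)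
  then have x: "?x \<in> V" "card V - ?h < deg ?x" using N by auto
  have "card (insert ?x (nbhd ?x)) = Suc (deg ?x)"
    using irr finite_nbhd by (auto simp: deg_def nbhd_def)
  then have far: "card (V - insert ?x (nbhd ?x)) = card V - Suc (deg ?x)"
    using x nbhd_subset finite_nbhd by (subst card_Diff_subset) auto
  have fm: "finite (missed P)" using finV by (simp add: missed_def)
  have "hd P \<in> missed P"
    using ends_nonadjacent[OF tight_path[OF T]] PD sym by (intro missedI) auto
  then have m1: "card (missed P - {hd P}) = ?h - 1"
    using missed_card[OF T] fm by simp
  have "0 < ?h"
    using \<open>?x \<in> nbhd (hd P)\<close> finite_nbhd by (auto simp: deg_def card_gt_0_iff)
  then have "card (V - insert ?x (nbhd ?x)) < card (missed P - {hd P})"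
    using far m1 x(2) n deg_less[OF x(1)] by linarith
  then have "\<not> missed P - {hd P} \<subseteq> V - insert ?x (nbhd ?x)"
    using card_mono[of "V - insert ?x (nbhd ?x)" "missed P - {hd P}"] finV by fastforce
  then obtain l where l: "l \<in> missed P" "l \<noteq> hd P" "l = ?x \<or> adj ?x l"
    by (auto simp: missed_def nbhd_def)
  have "l \<noteq> ?x" using missed_deg[OF T l(1)] x(2) n by auto
  then show ?thesis using that l sym by auto
qed

lemma tight_exists:
  assumes "u \<in> V" "v \<in> V" "u \<noteq> v" "\<not> adj u v" "Suc (deg u + deg v) = card V"
  obtains P where "tight P" "hd P = u" "last P = v"
  using sat[OF assms(1-4)] assms(5) by (auto simp: tight_def)

text \<open>
  The missed vertices are now exactly those of degree at most \<open>deg u\<close>, whatever the tight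
  path system is. So the trapped vertex \<open>m\<close>, not being missed, has degree \<open>deg u + 1\<close>, and its neighbours are the last
  vertex and all neighbours of the first one. This is one vertex too many of degree at most
  \<open>deg u + 1\<close>, or else makes \<open>w\<close>, being adjacent to \<open>m\<close>, a neighbour of the first vertex,
  which \<open>w\<close> misses like all low vertices.
\<close>
lemma few_low_vertices_impossible:
  assumes uv: "u \<in> V" "v \<in> V" "u \<noteq> v" "\<not> adj u v" "Suc (deg u + deg v) = card V"
    and n: "2 * deg u + 3 \<le> card V"
    and low: "low_count (deg u) \<le> deg u"
    and A: "low_count (Suc (deg u)) \<le> deg u \<or> (\<exists>w\<in>V. w \<noteq> v \<and> deg w = deg v)"
    and B: "(\<exists>x\<in>V. x \<noteq> u \<and> deg x = deg u) \<or> low_count (card V - deg u) \<le> card V - deg u"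
  shows False
proof -
  let ?K = "{x \<in> V. deg x \<le> deg u}"
  have fK: "finite ?K" using finV by simp
  have missed_eq: "missed P = ?K" if T: "tight P" and "deg (hd P) = deg u" for P
  proof (rule card_seteq[OF fK])
    show "missed P \<subseteq> ?K"
      using missed_deg[OF T] that(2) by (auto simp: missed_def)
    show "card ?K \<le> card (missed P)" using missed_card[OF T] that(2) low by (simp add: low_count_def)
  qed
  obtain P where P: "tight P" "hd P = u" "last P = v" using tight_exists[OF uv] .
  have "\<exists>P. tight P \<and> deg (hd P) = deg u \<and> last P = v \<and> 4 \<le> length P
     \<and> \<not> adj (hd P) (P ! (length P - 2))
     \<and> nbhd (P ! (length P - 2)) \<subseteq> insert (last P) (nbhd (hd P))"
  proof (cases "\<exists>x\<in>V. x \<noteq> u \<and> deg x = deg u")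
    case True
    then obtain x where x: "x \<in> missed P" "x \<noteq> hd P" "deg x = deg (hd P)"
      using missed_eq[OF P(1)] P(2) by auto
    obtain Q i where Q: "tight Q" "deg (hd Q) = deg (hd P)" "last Q = last P"
      "1 \<le> i" "Suc i < length Q" "\<not> adj (last Q) (Q ! i)"
      using exists_interior_missed[OF P(1) x] by metis
    then show ?thesis
      using trapped_penultimate_interior[OF Q(1) _ Q(4-6)] n P by (intro exI[of _ Q]) auto
  next
    case False
    then have c: "low_count (card V - deg (hd P)) \<le> card V - deg (hd P)" using B P(2) by auto
    obtain l where l: "l \<in> missed P" "l \<noteq> hd P" "adj l (P ! 1)"
      using spare_edge_of_high[OF P(1) _ c] n P(2) by auto
    then show ?thesis
      using trapped_penultimate_spare[OF P(1) _ l] n P by (intro exI[of _ P]) auto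
  qed
  then obtain Q where Q: "tight Q" "deg (hd Q) = deg u" "last Q = v" "4 \<le> length Q"
     "\<not> adj (hd Q) (Q ! (length Q - 2))"
     "nbhd (Q ! (length Q - 2)) \<subseteq> insert (last Q) (nbhd (hd Q))" by blast
  note QD = path_systemD[OF tight_path[OF Q(1)]]
  let ?m = "Q ! (length Q - 2)"
  have m: "?m \<in> V" "adj v ?m" using penultimate(1)[OF Q(1)] Q(3) sym adjV by blast+
  then have "?m \<notin> ?K" using missed_eq[OF Q(1,2)] Q(3) by (auto simp: missed_def nbhd_def)
  then have dm: "Suc (deg u) \<le> deg ?m" using m by auto
  have fin: "finite (insert (last Q) (nbhd (hd Q)))" using finite_nbhd by simp
  have cins: "card (insert (last Q) (nbhd (hd Q))) \<le> Suc (deg u)"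
    using card_insert_le_m1[of "Suc (deg u)" "nbhd (hd Q)" "last Q"] Q(2) by (simp add: deg_def)
  have dm': "deg ?m = Suc (deg u)"
    using card_mono[OF fin Q(6)] cins dm by (simp add: deg_def)
  have Neq: "nbhd ?m = insert (last Q) (nbhd (hd Q))"
    using card_seteq[OF fin Q(6)] cins dm by (simp add: deg_def)
  from A show False
  proof
    assume c: "low_count (Suc (deg u)) \<le> deg u"
    have "insert ?m ?K \<subseteq> {x \<in> V. deg x \<le> Suc (deg u)}" using m dm' by auto
    then have "card (insert ?m ?K) \<le> low_count (Suc (deg u))"
      unfolding low_count_def using finV by (intro card_mono) auto
    moreover have "card ?K = deg u" using missed_eq[OF Q(1,2)] missed_card[OF Q(1)] Q(2) by simp
    ultimately show False using c \<open>?m \<notin> ?K\<close> fK by simp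
  next
    assume "\<exists>w\<in>V. w \<noteq> v \<and> deg w = deg v"
    then obtain w where w: "w \<in> V" "w \<noteq> v" "deg w = deg v" by blast
    have "w \<noteq> ?m" using dm' w uv(5) n by auto
    then have "adj ?m w" using m w dm' uv(5) by (intro adj_if_deg_sum) auto
    then have "w \<in> nbhd (hd Q)" using Neq w Q(3) by (auto simp: nbhd_def)
    then have aw: "adj w (hd Q)" using sym by (simp add: nbhd_def)
    have "card (insert w (nbhd w)) = Suc (deg w)"
      using irr finite_nbhd by (auto simp: deg_def nbhd_def)
    then have "card (V - insert w (nbhd w)) = deg u"
      using w uv(5) nbhd_subset finite_nbhd by (subst card_Diff_subset) auto
    moreover have "V - insert w (nbhd w) \<subseteq> ?K"
    proof
      fix x assume x: "x \<in> V - insert w (nbhd w)"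
      then have "deg w + deg x < card V" using w by (intro nonadj_deg_sum) (auto simp: nbhd_def)
      then show "x \<in> ?K" using x w uv(5) by auto
    qed
    ultimately have "V - insert w (nbhd w) = ?K"
      using low fK by (intro card_seteq) (auto simp: low_count_def)
    moreover have "hd Q \<in> ?K" using QD Q(2) by simp
    ultimately show False using aw by (auto simp: nbhd_def)
  qed
qed

text \<open>
  The vertices of degree above \<open>deg v\<close> form the common neighbourhood of all vertices of degree \<open>deg u\<close>.
  So \<open>w\<close> is neither adjacent to \<open>u\<close> nor to the trapped vertex. Off the path this contradicts
  \<open>outside_end_adj\<close>; on the path, \<open>w\<close> and its predecessor form a gap that the missed
  vertices would have to jump over.
\<close>
lemma few_high_vertices_impossible:
  assumes uv: "u \<in> V" "v \<in> V" "u \<noteq> v" "\<not> adj u v" "Suc (deg u + deg v) = card V"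
    and n: "2 * deg u + 3 \<le> card V"
    and high: "low_count (deg v) \<le> card V - deg u"
    and A: "\<exists>w\<in>V. w \<noteq> v \<and> deg w = deg v"
    and B: "(\<exists>x\<in>V. x \<noteq> u \<and> deg x = deg u) \<or> low_count (card V - deg u) \<le> card V - deg u"
  shows False
proof -
  let ?A = "{x \<in> V. deg v < deg x}"
  have nb: "nbhd x = ?A" if "x \<in> V" "deg x = deg u" for x
    using high_is_nbhd[OF that(1), of "deg v"] that n uv(5) high by simp
  obtain P where P: "tight P" "hd P = u" "last P = v" using tight_exists[OF uv] .
  note PD = path_systemD[OF tight_path[OF P(1)]]
  let ?m = "P ! (length P - 2)"
  have x1: "P ! 1 \<in> nbhd u"
    using path_adj_Suc[OF tight_path[OF P(1)], of 0] PD P by (auto simp: nbhd_def)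
  obtain l where l: "l \<in> missed P" "l \<noteq> hd P" "adj l (P ! 1)"
  proof (cases "\<exists>x\<in>V. x \<noteq> u \<and> deg x = deg u")
    case True
    then obtain x where x: "x \<in> V" "x \<noteq> u" "deg x = deg u" by blast
    have "nbhd x = nbhd u" using nb[OF x(1,3)] nb[OF uv(1)] by simp
    then have "P ! 1 \<in> nbhd x" "v \<notin> nbhd x" using x1 uv(4) by (auto simp: nbhd_def)
    moreover have "x \<noteq> v" using x uv(5) n by auto
    ultimately show ?thesis using that[of x] x P by (auto simp: nbhd_def intro: missedI)
  next
    case False
    then have c: "low_count (card V - deg (hd P)) \<le> card V - deg (hd P)" using B P(2) by auto
    show ?thesis using spare_edge_of_high[OF P(1) _ c] n P(2) that by auto
  qed
  have trap: "4 \<le> length P" "\<not> adj u ?m" "nbhd ?m \<subseteq> insert v (nbhd u)"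
    using trapped_penultimate_spare[OF P(1) _ l] n unfolding P(2,3) by blast+
  obtain w where w: "w \<in> V" "w \<noteq> v" "deg w = deg v" using A by blast
  have "w \<notin> nbhd u" unfolding nb[OF uv(1) refl] using w by simp
  then have uw: "\<not> adj u w" by (simp add: nbhd_def)
  have mw: "\<not> adj w ?m"
  proof
    assume "adj w ?m"
    then have "w \<in> nbhd ?m" using sym by (simp add: nbhd_def)
    then show False using trap(3) uw w(2) by (auto simp: nbhd_def)
  qed
  show False
  proof (cases "w \<in> set P")
    case False
    then show False using outside_end_adj[OF P(1) trap(1) w(1)] w uw mw P by auto
  next
    case True
    then obtain i where i: "i < length P" "P ! i = w" by (auto simp: in_set_conv_nth)
    have "deg ?m \<le> Suc (deg u)"
      using card_mono[OF _ trap(3)] finite_nbhd card_insert_le_m1[of "Suc (deg u)" "nbhd u" v]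
      by (simp add: deg_def)
    then have "w \<noteq> ?m" "w \<noteq> u" using w uv(5) n by auto
    then have "i \<noteq> 0" "i \<noteq> length P - 2" using i PD(7) P by metis+
    moreover have "i \<noteq> length P - 1" "i \<noteq> 1"
      using i PD(8) P w uw x1 by (auto simp: nbhd_def)
    ultimately have i2: "2 \<le> i" "i + 3 \<le> length P" using i(1) by linarith+
    then obtain j where j: "i = Suc j" by (cases i) auto
    have "\<not> adj (hd P) (P ! Suc j)" using uw i j P by simp
    then have vj: "adj (last P) (P ! (i - 1))"
      using path_dichotomy[OF P(1), of j] i j by simp
    have "adj v w" using w uv n by (intro adj_if_deg_sum) auto
    then have vi: "adj (last P) (P ! i)" using i P by simp
    show False
    proof (cases "adj (last P) (P ! 2)")
      case True
      then show False using spare_edge_short[OF P(1) _ _ l] i2 by auto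
    next
      case False
      then show False using no_gap_after[OF P(1) _ i2 _ vi vj] i2 by auto
    qed
  qed
qed

text \<open>
  Let \<open>w\<close> be a candidate to replace the last vertex. By \<open>outside_end_adj\<close> it cannot
  lie off the path, since the trapped vertex is not adjacent to it. Turning over the part of the path
  that starts at \<open>w\<close> makes \<open>w\<close> the last vertex; propagation in the new path, which runs
  backwards in the old one, starts at the trapped vertex and arrives next to \<open>w\<close>. So \<open>w\<close>
  and its predecessor are seen by the old last vertex, but the successor of \<open>w\<close> is missed.
\<close>
lemma far_end_position:
  assumes T: "tight P" and n: "2 * deg (hd P) + 3 \<le> card V"
    and int: "1 \<le> a" "Suc a < length P" "\<not> adj (last P) (P ! a)"
    and w: "w \<in> V" "w \<noteq> last P" "deg w = deg (last P)" "\<not> adj (hd P) w"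
  obtains i where "2 \<le> i" "i + 5 \<le> length P" "P ! i = w" "adj (last P) (P ! i)"
    "adj (last P) (P ! (i - 1))" "\<not> adj (last P) (P ! Suc i)"
proof -
  note PP = tight_path[OF T]
  note PD = path_systemD[OF PP]
  let ?p = "length P" and ?u = "hd P" and ?v = "last P"
  let ?m = "P ! (?p - 2)"
  have dv: "Suc (deg ?u + deg ?v) = card V" using T by (simp add: tight_def)
  have trap: "5 \<le> ?p" "\<not> adj ?v (P ! (?p - 4))" "nbhd ?m \<subseteq> insert ?v (nbhd ?u)"
    using trapped_penultimate_interior[OF T n int] by auto
  have mw: "\<not> adj w ?m"
  proof
    assume "adj w ?m"
    then have "w \<in> nbhd ?m" using sym by (simp add: nbhd_def)
    then show False using trap(3) w by (auto simp: nbhd_def)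
  qed
  have "w \<in> set P"
  proof (rule ccontr)
    assume "w \<notin> set P"
    then show False using outside_end_adj[OF T _ w(1) _ w(3,4)] trap(1) mw by auto
  qed
  then obtain i where i: "i < ?p" "P ! i = w" by (auto simp: in_set_conv_nth)
  have "deg ?m \<le> Suc (deg ?u)"
    using card_mono[OF _ trap(3)] finite_nbhd card_insert_le_m1[of "Suc (deg ?u)" "nbhd ?u" ?v]
    by (simp add: deg_def)
  then have "w \<noteq> ?m" "w \<noteq> ?u" using w(3) dv n by auto
  then have "i \<noteq> ?p - 2" "i \<noteq> 0" "i \<noteq> ?p - 1" using i PD(7,8) w(2) by metis+
  moreover have "adj ?u (P ! 1)" using path_adj_Suc[OF PP, of 0] PD(1,7) by auto
  then have "i \<noteq> 1" using i w(4) by metis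
  moreover have s4: "adj ?u (P ! (?p - 3))"
  proof -
    have "Suc (?p - 4) = ?p - 3" using trap(1) by simp
    then show ?thesis using path_dichotomy[OF T, of "?p - 4"] trap(1,2) by simp
  qed
  then have "i \<noteq> ?p - 3" using i w(4) by metis
  moreover have vw: "adj ?v w" using w PD(10) dv n by (intro adj_if_deg_sum) auto
  then have "i \<noteq> ?p - 4" using trap(2) i by metis
  ultimately have i2: "2 \<le> i" "i + 5 \<le> ?p" using i(1) by linarith+
  obtain j where j: "i = Suc j" "1 \<le> j" using i2 by (cases i) auto
  have vj: "adj ?v (P ! j)" using path_dichotomy[OF T, of j] i j w(4) by auto
  let ?Q = "take i P @ rev (drop i P)"
  have Q: "path_system ?Q" using switch_end_path[OF PP _ vj] i j by auto
  have Qe: "hd ?Q = ?u" "last ?Q = w"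
    using i j PD(2) by (auto simp: last_rev hd_drop_conv_nth)
  have TQ: "tight ?Q" using Q Qe dv w(3) by (simp add: tight_def)
  have len: "length ?Q = ?p" by simp
  have Qn: "?Q ! q = P ! (?p - 1 + i - q)" if "i \<le> q" "q < ?p" for q
    using that i by (auto simp: nth_append rev_nth add.commute)
  \<comment> \<open>Position \<open>i + 1\<close> of \<open>?Q\<close> is the trapped vertex; each step of two in \<open>?Q\<close> goes back by two in \<open>P\<close>.\<close>
  have chain: "\<not> adj ?v (P ! (?p - 4 - 2 * k)) \<and> \<not> adj w (?Q ! (i + 1 + 2 * k))"
    if "i + 4 + 2 * k \<le> ?p" for k
    using that
  proof (induction k)
    case 0
    have "?Q ! (i + 1) = ?m" using Qn[of "i + 1"] i2 by (simp add: numeral_2_eq_2)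
    then show ?case using mw trap(2) by simp
  next
    case (Suc k)
    let ?q = "i + 1 + 2 * k"
    have IH: "\<not> adj w (?Q ! ?q)" using Suc by simp
    have "\<not> adj w (?Q ! (?q + 2))"
      using path_propagate[OF TQ, of ?q] IH Suc.prems i2 Qe len by auto
    then have "adj ?u (?Q ! Suc (?q + 2))"
      using path_dichotomy[OF TQ, of "?q + 2"] Suc.prems Qe len by auto
    moreover have "?Q ! Suc (?q + 2) = P ! Suc (?p - 4 - 2 * Suc k)"
    proof -
      have "Suc (?p - (6 + 2 * k)) = ?p - (5 + 2 * k)" using Suc.prems i2 by simp
      then show ?thesis using Qn[of "Suc (?q + 2)"] Suc.prems by simp
    qed
    ultimately have "\<not> adj ?v (P ! (?p - 4 - 2 * Suc k))"
      using path_dichotomy[OF T, of "?p - 4 - 2 * Suc k"] Suc.prems by auto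
    then show ?case using \<open>\<not> adj w (?Q ! (?q + 2))\<close> by simp
  qed
  have "\<not> adj ?v (P ! Suc i)"
  proof (cases "even (?p - 4 - i)")
    case True
    then obtain k where "?p - 4 - i = 2 * k" by blast
    then have "?p - 4 - 2 * k = i" "i + 4 + 2 * k \<le> ?p" using i2 by auto
    then show ?thesis using chain[of k] vw i by auto
  next
    case False
    then obtain k where "?p - 4 - i = 2 * k + 1" using oddE by blast
    then have "?p - 4 - 2 * k = Suc i" "i + 4 + 2 * k \<le> ?p" using i2 by auto
    then show ?thesis using chain[of k] by auto
  qed
  then show ?thesis using that[of i] i2 i vw vj j by auto
qed

text \<open>
  Conversely, a position \<open>i\<close> as in the preceding lemma leaves only one possibility for
  another missed vertex with the degree of the first vertex. In any other position, making it the new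
  first vertex would place a missed inner vertex in front of the gap at \<open>i - 1\<close> and \<open>i\<close>.
\<close>
lemma missed_twin_position:
  assumes T: "tight P"
    and i: "2 \<le> i" "i + 5 \<le> length P" "adj (last P) (P ! i)" "adj (last P) (P ! (i - 1))"
      "\<not> adj (last P) (P ! Suc i)"
    and x: "x \<in> missed P" "x \<noteq> hd P" "deg x = deg (hd P)"
  shows "x = P ! Suc i"
proof (cases "x \<in> set P")
  case False
  note PD = path_systemD[OF tight_path[OF T]]
  obtain C where C: "tight (C @ P)" "hd (C @ P) = x" "last (C @ P) = last P" "1 \<le> length C"
    using tight_switch_start_cycle[OF T x(1) False x(3)] by metis
  have "\<not> adj (last P) ((C @ P) ! length C)"
    using ends_nonadjacent[OF tight_path[OF T]] PD(1,7) by (auto simp: nth_append)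
  moreover have "(C @ P) ! (length C + i) = P ! i" "(C @ P) ! (length C + i - 1) = P ! (i - 1)"
    using i by (auto simp: nth_append)
  ultimately have False
    using no_gap_after[OF C(1), of "length C" "length C + i"] C(3,4) i by auto
  then show ?thesis ..
next
  case True
  note PD = path_systemD[OF tight_path[OF T]]
  obtain j where j: "Suc j < length P" "P ! j = x" "\<not> adj (last P) (P ! j)"
      "adj (hd P) (P ! Suc j)" "j + 3 \<le> length P"
    using missed_on_path[OF T x(1) True] by metis
  have "j \<noteq> 0" using j(2) x(2) PD(7) by metis
  have ij: "Suc i \<le> j"
  proof (rule ccontr)
    assume "\<not> Suc i \<le> j"
    then show False using no_gap_after[OF T _ _ _ j(3), of i] \<open>j \<noteq> 0\<close> i by auto
  qed
  show ?thesis
  proof (rule ccontr)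
    assume "x \<noteq> P ! Suc i"
    then have ij2: "i + 2 \<le> j" using ij j(2) by (cases "j = Suc i") auto
    let ?Q = "rev (take (Suc j) P) @ drop (Suc j) P"
    note Q = switch_start_path[OF tight_path[OF T] j(1,4)] and Qn = switch_start_path_nth[OF j(1)]
    have TQ: "tight ?Q" using T Q Qn(1,2) j(2) x(3) by (simp add: tight_def)
    have "?Q ! (j - Suc i) = P ! Suc i" "?Q ! (j - (i - 1)) = P ! (i - 1)" "?Q ! (j - (i - 1) - 1) = P ! i"
      using Qn(3)[of "j - Suc i"] Qn(3)[of "j - (i - 1)"] Qn(3)[of "j - (i - 1) - 1"] i ij2 by auto
    moreover have "1 \<le> j - Suc i" "j - Suc i \<le> j - (i - 1)" "j - (i - 1) + 3 \<le> length ?Q"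
      using ij2 i j by auto
    ultimately show False using no_gap_after[OF TQ, of "j - Suc i" "j - (i - 1)"] i Qn(2) by auto
  qed
qed

text \<open>
  In a path system with a missed inner vertex, the preceding lemmas and \<open>no_gap_after\<close> confine the
  vertices in question to the two ends and to the positions \<open>i\<close> and \<open>i + 1\<close>. So the last
  vertex misses at most two vertices of degree \<open>deg u\<close>, and the first vertex has at most
  two non-neighbours of degree \<open>deg v\<close>.
\<close>
lemma many_twins_impossible:
  assumes uv: "u \<in> V" "v \<in> V" "u \<noteq> v" "\<not> adj u v" "Suc (deg u + deg v) = card V"
    and n: "2 * deg u + 3 \<le> card V"
    and U2: "\<And>y. y \<in> V \<Longrightarrow> deg y = deg v \<Longrightarrow> 2 \<le> card {x \<in> V. deg x = deg u \<and> \<not> adj x y}"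
    and W2: "\<And>x. x \<in> V \<Longrightarrow> deg x = deg u \<Longrightarrow> 2 \<le> card {y \<in> V. deg y = deg v \<and> \<not> adj x y}"
    and UW3: "(\<forall>y\<in>V. deg y = deg v \<longrightarrow> 3 \<le> card {x \<in> V. deg x = deg u \<and> \<not> adj x y})
       \<or> (\<forall>x\<in>V. deg x = deg u \<longrightarrow> 3 \<le> card {y \<in> V. deg y = deg v \<and> \<not> adj x y})"
  shows False
proof -
  have other: "\<exists>x\<in>S. x \<noteq> a \<and> x \<noteq> b" if "3 \<le> card S" for S :: "'a set" and a b
  proof (rule ccontr)
    assume "\<not> ?thesis"
    then have "S \<subseteq> {a, b}" by blast
    then have "card S \<le> card {a, b}" by (intro card_mono) auto
    then show False using that card_insert_le_m1[of 2 "{b}" a] by simp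
  qed
  have other1: "\<exists>x\<in>S. x \<noteq> a" if "2 \<le> card S" for S :: "'a set" and a
  proof (rule ccontr)
    assume "\<not> ?thesis"
    then have "S \<subseteq> {a}" by blast
    then have "card S \<le> card {a}" by (intro card_mono) auto
    then show False using that by simp
  qed
  have duv: "deg u \<noteq> deg v" using uv(5) n by linarith
  obtain P0 where P0: "tight P0" "hd P0 = u" "last P0 = v" using tight_exists[OF uv] .
  obtain x0 where "x0 \<in> V" "deg x0 = deg u" "\<not> adj x0 v" "x0 \<noteq> u"
    using other1[OF U2[OF uv(2) refl], of u] by blast
  then have x0: "x0 \<in> missed P0" "x0 \<noteq> hd P0" "deg x0 = deg (hd P0)"
    using P0 duv by (auto intro: missedI)
  obtain P a where T: "tight P" and hu: "deg (hd P) = deg u" and lv: "last P = v"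
    and a: "1 \<le> a" "Suc a < length P" "\<not> adj (last P) (P ! a)"
    using exists_interior_missed[OF P0(1) x0] P0 by metis
  note PD = path_systemD[OF tight_path[OF T]]
  have n': "2 * deg (hd P) + 3 \<le> card V" using n hu by simp
  have pos: "\<exists>i. 2 \<le> i \<and> i + 5 \<le> length P \<and> P ! i = w \<and> adj (last P) (P ! i)
    \<and> adj (last P) (P ! (i - 1)) \<and> \<not> adj (last P) (P ! Suc i)"
    if "w \<in> V" "w \<noteq> v" "deg w = deg v" "\<not> adj (hd P) w" for w
    using far_end_position[OF T n' a that(1), unfolded lv, OF that(2-4)] lv by metis
  obtain w where w: "w \<in> V" "w \<noteq> v" "deg w = deg v" "\<not> adj (hd P) w"
    using other1[OF W2[OF PD(9) hu], of v] by blast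
  obtain i where i: "2 \<le> i" "i + 5 \<le> length P" "P ! i = w" "adj (last P) (P ! i)"
    "adj (last P) (P ! (i - 1))" "\<not> adj (last P) (P ! Suc i)" using pos[OF w] by blast
  from UW3 show False
  proof
    assume "\<forall>y\<in>V. deg y = deg v \<longrightarrow> 3 \<le> card {x \<in> V. deg x = deg u \<and> \<not> adj x y}"
    then have "3 \<le> card {x \<in> V. deg x = deg u \<and> \<not> adj x v}" using uv(2) by blast
    from other[OF this, of "hd P" "P ! Suc i"]
    obtain x where x: "x \<in> V" "deg x = deg u" "\<not> adj x v" "x \<noteq> hd P" "x \<noteq> P ! Suc i" by blast
    have "x \<in> missed P" using x duv lv by (intro missedI) auto
    then show False using missed_twin_position[OF T i(1,2,4-6)] x hu by auto
  next
    assume "\<forall>x\<in>V. deg x = deg u \<longrightarrow> 3 \<le> card {y \<in> V. deg y = deg v \<and> \<not> adj x y}"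
    then have "3 \<le> card {y \<in> V. deg y = deg v \<and> \<not> adj (hd P) y}" using PD(9) hu by blast
    from other[OF this, of v w]
    obtain y where y: "y \<in> V" "y \<noteq> v" "deg y = deg v" "\<not> adj (hd P) y" "y \<noteq> w" by blast
    obtain k where k: "2 \<le> k" "k + 5 \<le> length P" "P ! k = y" "adj (last P) (P ! k)"
      "adj (last P) (P ! (k - 1))" "\<not> adj (last P) (P ! Suc k)" using pos[OF y(1-4)] by blast
    have "i \<noteq> k" using i(3) k(3) y(5) by metis
    then consider "Suc i \<le> k" | "Suc k \<le> i" by linarith
    then show False
    proof cases
      case 1
      then show False using no_gap_after[OF T _ 1 _ i(6) k(4,5)] k by auto
    next
      case 2
      then show False using no_gap_after[OF T _ 2 _ k(6) i(4,5)] i by auto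
    qed
  qed
qed

end

section \<open>From the hypotheses to the three cases\<close>

text \<open>
  The negations of the four hypotheses on the degree sequence, with \<open>c k\<close> the number of vertices of
  degree at most \<open>k\<close>.
\<close>
definition bad_counts :: "nat \<Rightarrow> (nat \<Rightarrow> nat) \<Rightarrow> bool" where
  "bad_counts n c \<longleftrightarrow>
     odd n \<and> (n + 1) div 2 \<le> c ((n - 1) div 2)
   \<or> even n \<and> (n - 2) div 2 \<le> c (n div 2 - 1) \<and> (n + 2) div 2 \<le> c (n div 2)
   \<or> (\<exists>i. 2 * i + 2 \<le> n \<and> i \<le> c i \<and> i + 1 \<le> c (i + 1)
        \<and> n - i - 1 \<le> c (n - i - 2) \<and> n - i \<le> c (n - i - 1))
   \<or> (\<exists>i\<ge>1. 2 * i + 5 \<le> n \<and> i - 1 \<le> c i \<and> i + 2 \<le> c (i + 1)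
        \<and> n - i - 3 \<le> c (n - i - 3) \<and> n - i \<le> c (n - i - 2))"

lemma bad_counts_mono:
  assumes "\<And>k. c k \<le> c' k" "bad_counts n c"
  shows "bad_counts n c'"
  using assms(2) unfolding bad_counts_def
  by (elim disjE) (blast intro: le_trans[OF _ assms(1)])+

context saturated begin

lemma low_count_mono: "k \<le> l \<Longrightarrow> low_count k \<le> low_count l"
  unfolding low_count_def using finV by (intro card_mono) auto

lemma low_count_step:
  assumes "1 \<le> k"
  shows "low_count k = low_count (k - 1) + card {x \<in> V. deg x = k}"
proof -
  have "{x \<in> V. deg x \<le> k} = {x \<in> V. deg x \<le> k - 1} \<union> {x \<in> V. deg x = k}"
    using assms by auto
  also have "card \<dots> = card {x \<in> V. deg x \<le> k - 1} + card {x \<in> V. deg x = k}"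
    using finV assms by (intro card_Un_disjoint) auto
  finally show ?thesis by (simp add: low_count_def)
qed

lemma another_of_degree:
  assumes "2 \<le> card {x \<in> V. deg x = k}"
  shows "\<exists>w\<in>V. w \<noteq> v \<and> deg w = k"
proof (rule ccontr)
  assume "\<not> ?thesis"
  then have "{x \<in> V. deg x = k} \<subseteq> {v}" by blast
  then have "card {x \<in> V. deg x = k} \<le> card {v}" by (intro card_mono) auto
  then show False using assms by simp
qed

lemma card_non_nbhd: "card (V - nbhd x) = card V - deg x"
  using nbhd_subset finite_nbhd by (simp add: card_Diff_subset deg_def)

text \<open>
  A vertex \<open>y\<close> has \<open>n - 1 - deg y\<close> non-neighbours, all of degree at most \<open>a\<close> by the degree-sum
  bound. Those of degree less than \<open>a\<close> number at most \<open>low_count (a - 1)\<close>. The next lemma is the analogue for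
  a vertex of small degree, which is counted among its own non-neighbours.
\<close>
lemma nonadjacent_twins:
  assumes y: "y \<in> V" and ab: "1 \<le> a" "card V \<le> Suc (a + deg y)"
  shows "card V - Suc (deg y) \<le> low_count (a - 1) + card {x \<in> V. deg x = a \<and> \<not> adj x y}"
proof -
  let ?F = "V - insert y (nbhd y)" and ?T = "{x \<in> V. deg x = a \<and> \<not> adj x y}"
  have "card (insert y (nbhd y)) = Suc (deg y)"
    using irr finite_nbhd by (auto simp: deg_def nbhd_def)
  then have F: "card ?F = card V - Suc (deg y)"
    using y nbhd_subset finite_nbhd by (subst card_Diff_subset) auto
  have "?F \<subseteq> {x \<in> V. deg x \<le> a - 1} \<union> ?T"
  proof
    fix x assume x: "x \<in> ?F"
    then have na: "\<not> adj x y" using sym by (auto simp: nbhd_def)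
    have "deg x + deg y < card V" using x y na by (intro nonadj_deg_sum) auto
    then show "x \<in> {x \<in> V. deg x \<le> a - 1} \<union> ?T" using x na ab by auto
  qed
  then have "card ?F \<le> card ({x \<in> V. deg x \<le> a - 1} \<union> ?T)"
    using finV by (intro card_mono) auto
  also have "\<dots> \<le> low_count (a - 1) + card ?T" unfolding low_count_def by (rule card_Un_le)
  finally show ?thesis using F by simp
qed

lemma nonadjacent_far_twins:
  assumes x: "x \<in> V" and b: "1 \<le> b" "card V \<le> Suc (deg x + b)" "deg x < b"
  shows "card V - deg x \<le> low_count (b - 1) + card {y \<in> V. deg y = b \<and> \<not> adj x y}"
proof -
  let ?T = "{y \<in> V. deg y = b \<and> \<not> adj x y}"
  have "V - nbhd x \<subseteq> {y \<in> V. deg y \<le> b - 1} \<union> ?T"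
  proof
    fix y assume y: "y \<in> V - nbhd x"
    then have na: "\<not> adj x y" by (simp add: nbhd_def)
    show "y \<in> {y \<in> V. deg y \<le> b - 1} \<union> ?T"
    proof (cases "y = x")
      case True
      then show ?thesis using x b by auto
    next
      case False
      then have "deg x + deg y < card V" using x y na by (intro nonadj_deg_sum) auto
      then show ?thesis using y na b by auto
    qed
  qed
  then have "card (V - nbhd x) \<le> card ({y \<in> V. deg y \<le> b - 1} \<union> ?T)"
    using finV by (intro card_mono) auto
  also have "\<dots> \<le> low_count (b - 1) + card ?T" unfolding low_count_def by (rule card_Un_le)
  finally show ?thesis by (simp add: card_non_nbhd)
qed

lemma not_complete:
  assumes "3 \<le> card V"
  shows "\<exists>u\<in>V. \<exists>v\<in>V. u \<noteq> v \<and> \<not> adj u v"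
proof (rule ccontr)
  assume "\<not> ?thesis"
  then have all: "adj x y" if "x \<in> V" "y \<in> V" "x \<noteq> y" for x y using that by blast
  obtain C where C: "set C = V" "distinct C" using finite_distinct_list[OF finV] by blast
  then have len: "length C = card V" using distinct_card by fastforce
  have "successively adj C"
    unfolding successively_conv_nth using C all nth_mem nth_eq_iff_index_eq
    by (metis Suc_lessD n_not_Suc_n)
  moreover have "adj (last C) (hd C)"
  proof (rule all)
    have ne: "C \<noteq> []" using len assms by auto
    then show "last C \<in> V" "hd C \<in> V" using C by auto
    have "C ! (length C - 1) \<noteq> C ! 0"
      using C(2) len assms by (subst nth_eq_iff_index_eq) auto
    then show "last C \<noteq> hd C" using ne by (simp add: last_conv_nth hd_conv_nth)
  qed
  ultimately have "is_cycle adj C" using C len assms by (simp add: is_cycle_def)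
  then show False using cycle_cover_cycle C no_cover by metis
qed

text \<open>
  Chvatal's choice of a non-adjacent pair with maximal degree sum: the non-neighbours of each
  end have at most the degree of the other end, which yields two of the counts in \<open>bad_counts\<close>.
  If none of the alternatives holds, there are enough further vertices of the two critical degrees
  for one of the three preceding impossibility results to apply.
\<close>
lemma bad_degree_counts:
  assumes n3: "3 \<le> card V"
  shows "bad_counts (card V) low_count"
proof (rule ccontr)
  assume good: "\<not> bad_counts (card V) low_count"
  define S where "S = {(x, y). x \<in> V \<and> y \<in> V \<and> x \<noteq> y \<and> \<not> adj x y}"
  define f where "f = (\<lambda>(x, y). deg x + deg y)"
  have "S \<subseteq> V \<times> V" by (auto simp: S_def)
  then have "finite S" using finV by (meson finite_SigmaI finite_subset)
  moreover have "S \<noteq> {}" using not_complete[OF n3] by (auto simp: S_def)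
  ultimately have fin: "finite (f ` S)" "f ` S \<noteq> {}" by auto
  then have "Max (f ` S) \<in> f ` S" by (rule Max_in)
  then obtain a b where ab: "(a, b) \<in> S" "Max (f ` S) = f (a, b)" by auto
  have max': "f p \<le> f (a, b)" if "p \<in> S" for p
    using Max_ge[OF fin(1) imageI[OF that]] unfolding ab(2) .
  define u where "u = (if deg a \<le> deg b then a else b)"
  define v where "v = (if deg a \<le> deg b then b else a)"
  have uv: "u \<in> V" "v \<in> V" "u \<noteq> v" "\<not> adj u v" "deg u \<le> deg v"
    using ab(1) sym by (auto simp: S_def u_def v_def)
  have max: "deg x + deg y \<le> deg u + deg v" if "x \<in> V" "y \<in> V" "x \<noteq> y" "\<not> adj x y" for x y
    using max'[of "(x, y)"] that by (auto simp: S_def f_def u_def v_def split: if_splits)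
  have sum: "deg u + deg v < card V" using nonadj_deg_sum uv by blast
  have cu: "card V - Suc (deg v) \<le> low_count (deg u)"
  proof -
    have "card (insert v (nbhd v)) = Suc (deg v)"
      using irr finite_nbhd by (auto simp: deg_def nbhd_def)
    then have "card (V - insert v (nbhd v)) = card V - Suc (deg v)"
      using uv(2) nbhd_subset finite_nbhd by (subst card_Diff_subset) auto
    moreover have "V - insert v (nbhd v) \<subseteq> {x \<in> V. deg x \<le> deg u}"
      using max[of v] uv(2) by (auto simp: nbhd_def)
    then have "card (V - insert v (nbhd v)) \<le> low_count (deg u)"
      unfolding low_count_def using finV by (intro card_mono) auto
    ultimately show ?thesis by simp
  qed
  have cv: "card V - deg u \<le> low_count (deg v)"
  proof -
    have "V - nbhd u \<subseteq> {x \<in> V. deg x \<le> deg v}"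
    proof
      fix x assume x: "x \<in> V - nbhd u"
      then show "x \<in> {x \<in> V. deg x \<le> deg v}"
        using max[of u x] uv by (cases "x = u") (auto simp: nbhd_def)
    qed
    then have "card (V - nbhd u) \<le> low_count (deg v)"
      unfolding low_count_def using finV by (intro card_mono) auto
    then show ?thesis by (simp add: card_non_nbhd)
  qed
  define n where "n = card V"
  define h where "h = deg u"
  have good3: "\<not> (2 * i + 2 \<le> n \<and> i \<le> low_count i \<and> i + 1 \<le> low_count (i + 1)
        \<and> n - i - 1 \<le> low_count (n - i - 2) \<and> n - i \<le> low_count (n - i - 1))" for i
    using good unfolding bad_counts_def n_def by blast
  have tight: "Suc (deg u + deg v) = card V"
  proof (rule ccontr)
    assume "\<not> ?thesis"
    then have less: "h + deg v + 2 \<le> n" using sum by (simp add: n_def h_def)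
    have "h + 1 \<le> low_count h" using cu less by (simp add: n_def h_def)
    moreover have "low_count h \<le> low_count (h + 1)" by (rule low_count_mono) simp
    moreover have "deg v \<le> n - h - 2" using less by linarith
    then have "n - h \<le> low_count (n - h - 2)"
      using cv low_count_mono le_trans unfolding n_def h_def by blast
    moreover have "low_count (n - h - 2) \<le> low_count (n - h - 1)" by (rule low_count_mono) simp
    ultimately show False using good3[of h] less uv(5) by (simp add: h_def)
  qed
  have dv: "deg v = n - h - 1" "h + deg v + 1 = n" using tight by (auto simp: n_def h_def)
  have ch: "h \<le> low_count h" using cu dv by (simp add: n_def h_def)
  have cnh: "n - h \<le> low_count (n - h - 1)" using cv dv by (simp add: n_def h_def)
  have h1: "1 \<le> h"
  proof -
    have "nbhd v \<subseteq> V - {u, v}" using nbhd_subset uv irr sym by (auto simp: nbhd_def)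
    then have "deg v \<le> card (V - {u, v})" unfolding deg_def using finV by (intro card_mono) auto
    also have "\<dots> = n - 2" using uv by (simp add: n_def card_Diff_subset)
    finally show ?thesis using dv n3 by (simp add: n_def)
  qed
  \<comment> \<open>The two smallest values of \<open>n\<close> are where the hypotheses on the middle of the sequence enter.\<close>
  have "n \<noteq> 2 * h + 1"
  proof
    assume n: "n = 2 * h + 1"
    then show False using good cnh unfolding bad_counts_def n_def[symmetric] by simp
  qed
  moreover have "n \<noteq> 2 * h + 2"
  proof
    assume n: "n = 2 * h + 2"
    then show False using good cnh ch unfolding bad_counts_def n_def[symmetric] by simp
  qed
  ultimately have nh: "2 * h + 3 \<le> n" using uv(5) dv by (simp add: h_def)
  \<comment> \<open>The third alternative of \<open>bad_counts\<close> is excluded at \<open>i = h\<close>, and below at \<open>i = k = h - 1\<close>.\<close>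
  have P: "low_count (h + 1) \<le> h \<or> low_count (n - h - 2) + 2 \<le> n - h"
    using good3[of h] ch cnh nh by linarith
  obtain k where k: "h = Suc k" using h1 by (cases h) auto
  have nk: "n - k - 1 = n - h" "n - k - 2 = n - h - 1" "n - k - 3 = n - h - 2" "n - k = n - h + 1"
    using k nh by auto
  have Q: "low_count (h - 1) + 2 \<le> h \<or> low_count (n - h) \<le> n - h"
  proof (rule ccontr)
    assume "\<not> ?thesis"
    then have "k \<le> low_count k" "n - k \<le> low_count (n - k - 1)" using k nk by auto
    moreover have "k + 1 \<le> low_count (k + 1)" "n - k - 1 \<le> low_count (n - k - 2)" "2 * k + 2 \<le> n"
      using ch cnh nk k nh by auto
    ultimately show False using good3[of k] by blast
  qed
  have A: "\<exists>w\<in>V. w \<noteq> v \<and> deg w = deg v" if "low_count (n - h - 2) + 2 \<le> n - h"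
  proof -
    have "1 \<le> n - h - 1" "n - h - 1 - 1 = n - h - 2" using nh by auto
    then have "2 \<le> card {x \<in> V. deg x = n - h - 1}"
      using low_count_step[of "n - h - 1"] cnh that by simp
    then show ?thesis using another_of_degree dv(1) by simp
  qed
  have B: "\<exists>x\<in>V. x \<noteq> u \<and> deg x = deg u" if "low_count (h - 1) + 2 \<le> h"
  proof -
    have "2 \<le> card {x \<in> V. deg x = h}" using low_count_step[OF h1] ch that by linarith
    then show ?thesis using another_of_degree unfolding h_def by blast
  qed
  have n': "2 * deg u + 3 \<le> card V" using nh by (simp add: n_def h_def)
  show False
  proof (cases "low_count h \<le> h")
    case True
    have 1: "low_count (Suc (deg u)) \<le> deg u \<or> (\<exists>w\<in>V. w \<noteq> v \<and> deg w = deg v)"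
      using P A unfolding h_def by auto
    have 2: "(\<exists>x\<in>V. x \<noteq> u \<and> deg x = deg u) \<or> low_count (card V - deg u) \<le> card V - deg u"
      using Q B unfolding h_def n_def by blast
    show False
      using few_low_vertices_impossible[OF uv(1-4) tight n' _ 1 2] True unfolding h_def by blast
  next
    case c1: False
    then have P2: "low_count (n - h - 2) + 2 \<le> n - h" using P low_count_mono[of h "h + 1"] by auto
    show False
    proof (cases "low_count (deg v) \<le> n - h")
      case True
      have 2: "(\<exists>x\<in>V. x \<noteq> u \<and> deg x = deg u) \<or> low_count (card V - deg u) \<le> card V - deg u"
        using Q B unfolding h_def n_def by blast
      show False
        using few_high_vertices_impossible[OF uv(1-4) tight n' _ A[OF P2] 2] True
        unfolding h_def n_def by blast
    next
      case c2: False
      have "n - h - 1 \<le> n - h" by simp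
      then have "n - h < low_count (n - h)" using low_count_mono c2 unfolding dv(1) by (meson le_trans not_le)
      then have Q1: "low_count (h - 1) + 2 \<le> h" using Q by auto
      have U: "h \<le> low_count (h - 1) + card {x \<in> V. deg x = deg u \<and> \<not> adj x y}"
        if "y \<in> V" "deg y = deg v" for y
        using nonadjacent_twins[OF that(1) h1] that(2) dv by (simp add: n_def h_def)
      have W: "n - h \<le> low_count (n - h - 2) + card {y \<in> V. deg y = deg v \<and> \<not> adj x y}"
        if "x \<in> V" "deg x = deg u" for x
      proof -
        have "1 \<le> n - h - 1" "card V \<le> Suc (deg x + (n - h - 1))" "deg x < n - h - 1"
          using that(2) nh unfolding h_def[symmetric] n_def[symmetric] by linarith+
        moreover have "n - h - 1 - 1 = n - h - 2" by simp
        ultimately show ?thesis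
          using nonadjacent_far_twins[OF that(1), of "n - h - 1"] that(2) dv(1)
          unfolding h_def[symmetric] n_def[symmetric] by simp
      qed
      have "low_count (h - 1) + 3 \<le> h \<or> low_count (n - h - 2) + 3 \<le> n - h"
      proof (rule ccontr)
        assume "\<not> ?thesis"
        then have "k - 1 \<le> low_count k" "n - k - 3 \<le> low_count (n - k - 3)" using k nk by auto
        moreover have "1 \<le> k" "2 * k + 5 \<le> n" using Q1 k nh by auto
        moreover have "k + 2 \<le> low_count (k + 1)" "n - k \<le> low_count (n - k - 2)"
          using c1 c2 dv(1) k nk by auto
        \<comment> \<open>The last alternative of \<open>bad_counts\<close> at \<open>i = k = h - 1\<close>.\<close>
        ultimately show False using good unfolding bad_counts_def n_def[symmetric] by blast
      qed
      then have "(\<forall>y\<in>V. deg y = deg v \<longrightarrow> 3 \<le> card {x \<in> V. deg x = deg u \<and> \<not> adj x y})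
          \<or> (\<forall>x\<in>V. deg x = deg u \<longrightarrow> 3 \<le> card {y \<in> V. deg y = deg v \<and> \<not> adj x y})"
      proof
        assume c: "low_count (h - 1) + 3 \<le> h"
        have "3 \<le> card {x \<in> V. deg x = deg u \<and> \<not> adj x y}" if "y \<in> V" "deg y = deg v" for y
          using U[OF that] c by linarith
        then show ?thesis by blast
      next
        assume c: "low_count (n - h - 2) + 3 \<le> n - h"
        have "3 \<le> card {y \<in> V. deg y = deg v \<and> \<not> adj x y}" if "x \<in> V" "deg x = deg u" for x
          using W[OF that] c by linarith
        then show ?thesis by blast
      qed
      from many_twins_impossible[OF uv(1-4) tight n' _ _ this] show False
      proof
        show "2 \<le> card {x \<in> V. deg x = deg u \<and> \<not> adj x y}" if "y \<in> V" "deg y = deg v" for y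
          using U[OF that] Q1 by linarith
        show "2 \<le> card {y \<in> V. deg y = deg v \<and> \<not> adj x y}" if "x \<in> V" "deg x = deg u" for x
          using W[OF that] P2 by linarith
      qed
    qed
  qed
qed

end

section \<open>Passing to an edge-maximal graph\<close>

lemma cycle_cover_mono_on:
  assumes "cycle_cover adj' Z" "\<And>x y. x \<in> Z \<Longrightarrow> y \<in> Z \<Longrightarrow> adj' x y \<Longrightarrow> adj x y"
  shows "cycle_cover adj Z"
  using assms
proof (induction rule: cycle_cover.induct)
  case (insert Z C)
  have "C \<noteq> []" using insert.hyps(2) by (rule is_cycle_nonempty)
  then have "adj (last C) (hd C)"
    using insert.hyps(2) insert.prems[of "last C" "hd C"] by (auto simp: is_cycle_def)
  moreover have "successively adj C"
    using insert.hyps(2) insert.prems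
    by (auto simp: is_cycle_def intro: successively_mono)
  ultimately have "is_cycle adj C" using insert.hyps(2) by (auto simp: is_cycle_def)
  then show ?case using insert by (intro cycle_cover.insert) auto
qed (rule cycle_cover.empty)

context graph_adj begin

text \<open>
  Cut the cycle through \<open>u\<close> at the new edge if it uses it; no other cycle can use it.
\<close>
lemma path_system_of_added_edge:
  assumes uv: "u \<in> V" "v \<in> V" "u \<noteq> v"
    and adj': "\<And>x y. adj' x y \<longleftrightarrow> adj x y \<or> x = u \<and> y = v \<or> x = v \<and> y = u"
    and cov: "cycle_cover adj' V"
  shows "cycle_cover adj V \<or> (\<exists>P. path_system P \<and> hd P = u \<and> last P = v)"
proof -
  obtain C where C: "is_cycle adj' C" "hd C = u" "set C \<subseteq> V" "cycle_cover adj' (V - set C)"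
    using cycle_cover_rotate_to[OF cov uv(1)] by blast
  obtain xs where Cx: "C = u # xs" using C(2) is_cycle_nonempty[OF C(1)] by (cases C) auto
  have xs: "u \<notin> set xs" "distinct xs" "2 \<le> length xs" "successively adj' xs"
      "adj' u (hd xs)" "adj' (last xs) u" "xs \<noteq> []"
    using C(1) unfolding Cx is_cycle_def by (auto simp: successively_Cons split: if_splits)
  have sxs: "successively adj xs"
    by (rule successively_mono[OF xs(4)]) (use adj' xs(1) in auto)
  have rest: "cycle_cover adj (V - set C)"
    by (rule cycle_cover_mono_on[OF C(4)]) (use adj' C(2) Cx in auto)
  have VC: "set C \<union> (V - set C) = V" using C(3) by blast
  have ne: "hd xs \<noteq> last xs"
  proof
    assume "hd xs = last xs"
    then have "xs ! 0 = xs ! (length xs - 1)" using xs(7) by (simp add: hd_conv_nth last_conv_nth)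
    then show False using xs(2,3) by (subst (asm) nth_eq_iff_index_eq) auto
  qed
  consider "hd xs = v" | "last xs = v" | "hd xs \<noteq> v" "last xs \<noteq> v" by blast
  then show ?thesis
  proof cases
    case 1
    then have "adj u (last xs)" using xs(6) ne adj' sym uv(3) by metis
    then have "path_system (u # rev xs)"
      unfolding path_system_def
      using xs sxs C(3) Cx rest by (auto simp: successively_Cons successively_rev_adj hd_rev
          simp del: successively_rev)
    moreover have "last (u # rev xs) = v" using 1 xs(7) by (simp add: last_rev)
    ultimately show ?thesis by (metis list.sel(1))
  next
    case 2
    then have "adj u (hd xs)" using xs(5) ne adj' uv(3) by metis
    then have "path_system C"
      unfolding path_system_def
      using xs sxs C(3) Cx rest by (auto simp: successively_Cons)
    moreover have "last C = v" using 2 Cx xs(7) by simp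
    ultimately show ?thesis using C(2) by blast
  next
    case 3
    have "u \<noteq> hd xs" "u \<noteq> last xs" using xs(1,7) by auto
    then have "adj u (hd xs)" "adj (last xs) u" using xs(5,6) 3 adj' by metis+
    then have "is_cycle adj C"
      unfolding is_cycle_def using xs sxs Cx by (auto simp: successively_Cons)
    then show ?thesis using cycle_cover.insert[OF rest, of C] VC by auto
  qed
qed

end

text \<open>
  Induction on the number of non-adjacent pairs: an edge is added as long as no cycle cover
  arises, which only lowers the counts.
\<close>
lemma bad_counts_if_no_cover:
  assumes "graph_adj V adj" "\<not> cycle_cover adj V" "3 \<le> card V"
  shows "bad_counts (card V) (\<lambda>k. card {x \<in> V. graph_adj.deg adj x \<le> k})"
  using assms
proof (induction "card {(x, y). x \<in> V \<and> y \<in> V \<and> \<not> adj x y}" arbitrary: adj rule: less_induct)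
  case less
  interpret G: graph_adj V adj by fact
  show ?case
  proof (cases "\<forall>u v. u \<in> V \<longrightarrow> v \<in> V \<longrightarrow> u \<noteq> v \<longrightarrow> \<not> adj u v
      \<longrightarrow> (\<exists>P. G.path_system P \<and> hd P = u \<and> last P = v)")
    case True
    interpret saturated V adj
    proof
      show "\<not> cycle_cover adj V" by (rule less.prems(2))
    qed (rule True[rule_format])
    have eq: "low_count = (\<lambda>k. card {x \<in> V. G.deg x \<le> k})"
      by (rule ext) (rule low_count_def)
    show ?thesis using bad_degree_counts[OF less.prems(3)] unfolding eq .
  next
    case False
    then obtain u v where uv: "u \<in> V" "v \<in> V" "u \<noteq> v" "\<not> adj u v"
      "\<not> (\<exists>P. G.path_system P \<and> hd P = u \<and> last P = v)" by blast
    define adj' where "adj' = (\<lambda>x y. adj x y \<or> x = u \<and> y = v \<or> x = v \<and> y = u)"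
    interpret G': graph_adj V adj'
    proof
      show "finite V" by (rule G.finV)
      show "adj' y x" if "adj' x y" for x y using that G.sym unfolding adj'_def by blast
      show "\<not> adj' x x" for x using G.irr uv(3) unfolding adj'_def by blast
      show "x \<in> V" if "adj' x y" for x y using that G.adjV uv(1,2) unfolding adj'_def by blast
    qed
    have nc: "\<not> cycle_cover adj' V"
      using G.path_system_of_added_edge[OF uv(1-3), of adj'] uv(5) less.prems(2)
      unfolding adj'_def by blast
    have "{(x, y). x \<in> V \<and> y \<in> V \<and> \<not> adj' x y} \<subset> {(x, y). x \<in> V \<and> y \<in> V \<and> \<not> adj x y}"
      using uv by (auto simp: adj'_def)
    moreover have "finite {(x, y). x \<in> V \<and> y \<in> V \<and> \<not> adj x y}"
      by (rule finite_subset[of _ "V \<times> V"]) (auto simp: G.finV)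
    ultimately have "card {(x, y). x \<in> V \<and> y \<in> V \<and> \<not> adj' x y}
        < card {(x, y). x \<in> V \<and> y \<in> V \<and> \<not> adj x y}"
      by (simp add: psubset_card_mono)
    from less.hyps[OF this G'.graph_adj_axioms nc less.prems(3)]
    have bad: "bad_counts (card V) (\<lambda>k. card {x \<in> V. G'.deg x \<le> k})" .
    have "G.deg x \<le> G'.deg x" for x
      unfolding G.deg_def G'.deg_def
      by (rule card_mono[OF G'.finite_nbhd]) (unfold G.nbhd_def G'.nbhd_def, auto simp: adj'_def)
    then have "card {x \<in> V. G'.deg x \<le> k} \<le> card {x \<in> V. G.deg x \<le> k}" for k
      using G.finV by (intro card_mono) (auto intro: le_trans)
    then show ?thesis by (rule bad_counts_mono[OF _ bad])
  qed
qed

section \<open>Edge sets and degree sequences\<close>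

definition cycle_edges :: "'a list \<Rightarrow> 'a set set" where
  "cycle_edges C = (\<lambda>(x, y). {x, y}) ` set (zip C (rotate1 C))"

lemma zip_rotate1:
  "length xs = length ys \<Longrightarrow> zip (rotate1 xs) (rotate1 ys) = rotate1 (zip xs ys)"
  by (cases xs; cases ys) auto

lemma cycle_edges_rotate: "cycle_edges (rotate k C) = cycle_edges C"
proof (induction k)
  case (Suc k)
  have "cycle_edges (rotate1 D) = cycle_edges D" for D :: "'a list"
    unfolding cycle_edges_def by (subst zip_rotate1) auto
  then show ?case using Suc by simp
qed simp

text \<open>
  By rotation invariance \<open>v\<close> may be taken as the first vertex. Its two edges differ because
  the cycle has at least three vertices.
\<close>
lemma cycle_edges_degree:
  assumes C: "is_cycle adj C" and v: "v \<in> set C"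
  shows "card {e \<in> cycle_edges C. v \<in> e} = 2"
proof -
  obtain i where i: "i < length C" "C ! i = v" using v by (auto simp: in_set_conv_nth)
  define D where "D = rotate i C"
  have D: "is_cycle adj D" "cycle_edges D = cycle_edges C"
    using is_cycle_rotate[OF C] cycle_edges_rotate by (auto simp: D_def)
  have "hd D = v"
    using i rotate_hd_last(1)[of i C] by (cases "i = 0") (auto simp: D_def hd_conv_nth)
  then obtain xs where Dx: "D = v # xs" using is_cycle_nonempty[OF D(1)] by (cases D) auto
  obtain y ws where xs: "xs = y # ws" using D(1) Dx by (cases xs) (auto simp: is_cycle_def)
  obtain us z where ws: "ws = us @ [z]"
    using D(1) Dx xs by (cases ws rule: rev_cases) (auto simp: is_cycle_def)
  have dist: "distinct (v # y # us @ [z])" using D(1) Dx xs ws by (simp add: is_cycle_def)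
  have "zip D (rotate1 D) = (v, y) # zip (y # us) (us @ [z]) @ [(z, v)]"
    by (simp add: Dx xs ws zip_append[of "y # us" "us @ [z]" "[z]" "[v]", simplified])
  then have "{e \<in> cycle_edges D. v \<in> e} = {{v, y}, {z, v}}"
    using dist unfolding cycle_edges_def by (auto dest: set_zip_leftD set_zip_rightD)
  moreover have "{v, y} \<noteq> {z, v}" using dist by (auto simp: doubleton_eq_iff)
  ultimately show ?thesis using D(2) by (simp add: card_insert_if)
qed

lemma cycle_edges_adj:
  assumes "is_cycle adj C" "e \<in> cycle_edges C"
  shows "\<exists>x y. e = {x, y} \<and> adj x y \<and> x \<in> set C \<and> y \<in> set C"
proof -
  obtain x xs where C: "C = x # xs" using is_cycle_nonempty[OF assms(1)] by (cases C) auto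
  obtain a b where ab: "(a, b) \<in> set (zip C (rotate1 C))" "e = {a, b}"
    using assms(2) by (auto simp: cycle_edges_def)
  then obtain i where i: "i < length C" "a = C ! i" "b = rotate1 C ! i"
    by (auto simp: set_zip)
  have "adj a b"
  proof (cases "Suc i < length C")
    case True
    then show ?thesis using assms(1) i by (auto simp: is_cycle_def successively_conv_nth nth_rotate1)
  next
    case False
    then have "i = length C - 1" "Suc i = length C" using i by auto
    then have "a = last C" "b = hd C"
      using i is_cycle_nonempty[OF assms(1)] by (auto simp: nth_rotate1 last_conv_nth hd_conv_nth)
    then show ?thesis using assms(1) by (simp add: is_cycle_def)
  qed
  moreover have "a \<in> set C" "b \<in> set C"
    using ab(1) set_zip_leftD[of a b] set_zip_rightD[of a b] by (metis, metis set_rotate1)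
  ultimately show ?thesis using ab(2) by blast
qed

lemma cycle_cover_edges:
  assumes "cycle_cover adj Z"
  shows "\<exists>F. (\<forall>e\<in>F. \<exists>x y. e = {x, y} \<and> adj x y \<and> x \<in> Z \<and> y \<in> Z)
    \<and> (\<forall>v\<in>Z. card {e \<in> F. v \<in> e} = 2)"
  using assms
proof (induction rule: cycle_cover.induct)
  case empty
  then show ?case by (intro exI[of _ "{}"]) auto
next
  case (insert Z C)
  then obtain F where F: "\<forall>e\<in>F. \<exists>x y. e = {x, y} \<and> adj x y \<and> x \<in> Z \<and> y \<in> Z"
    "\<forall>v\<in>Z. card {e \<in> F. v \<in> e} = 2" by blast
  have FZ: "e \<subseteq> Z" if e: "e \<in> F" for e
  proof -
    obtain x y where "e = {x, y}" "x \<in> Z" "y \<in> Z" using F(1) e by metis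
    then show ?thesis by simp
  qed
  have CC: "e \<subseteq> set C" if e: "e \<in> cycle_edges C" for e
  proof -
    obtain x y where "e = {x, y}" "x \<in> set C" "y \<in> set C"
      using cycle_edges_adj[OF insert.hyps(2) e] by metis
    then show ?thesis by simp
  qed
  have "card {e \<in> F \<union> cycle_edges C. v \<in> e} = 2" if v: "v \<in> set C \<union> Z" for v
  proof (cases "v \<in> set C")
    case True
    then have "{e \<in> F \<union> cycle_edges C. v \<in> e} = {e \<in> cycle_edges C. v \<in> e}"
      using FZ insert.hyps(3) by blast
    then show ?thesis using cycle_edges_degree[OF insert.hyps(2) True] by simp
  next
    case False
    then have "{e \<in> F \<union> cycle_edges C. v \<in> e} = {e \<in> F. v \<in> e}"
      using CC by blast
    then show ?thesis using F(2) v False by simp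
  qed
  moreover have "\<exists>x y. e = {x, y} \<and> adj x y \<and> x \<in> set C \<union> Z \<and> y \<in> set C \<union> Z"
    if "e \<in> F \<union> cycle_edges C" for e
    using that bspec[OF F(1), of e] cycle_edges_adj[OF insert.hyps(2), of e]
    by (metis UnCI UnE)
  ultimately show ?case by (intro exI[of _ "F \<union> cycle_edges C"]) simp
qed

lemma sorted_nth_le_iff:
  assumes "sorted xs" "1 \<le> j" "j \<le> length xs"
  shows "xs ! (j - 1) \<le> k \<longleftrightarrow> j \<le> length (filter (\<lambda>x. x \<le> k) xs)"
  using assms
proof (induction xs arbitrary: j)
  case Nil
  then show ?case by simp
next
  case (Cons a xs)
  show ?case
  proof (cases "a \<le> k")
    case True
    then show ?thesis using Cons.IH[of "j - 1"] Cons.prems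
      by (cases "j = 1") (auto simp: nth_Cons' le_diff_conv)
  next
    case False
    then have "\<forall>x\<in>set xs. \<not> x \<le> k" using Cons.prems by auto
    then have "filter (\<lambda>x. x \<le> k) (a # xs) = []" using False by (simp add: filter_empty_conv)
    moreover have "(a # xs) ! (j - 1) \<in> set (a # xs)" using Cons.prems by (intro nth_mem) auto
    then have "\<not> (a # xs) ! (j - 1) \<le> k" using \<open>\<forall>x\<in>set xs. \<not> x \<le> k\<close> False by auto
    ultimately show ?thesis using Cons.prems by simp
  qed
qed

lemma deg_entry_le_iff:
  assumes "finite V" "j \<le> card V"
  shows "deg_entry V E j \<le> k \<longleftrightarrow> j \<le> card {x \<in> V. degree E x \<le> k}"
proof (cases "j = 0")
  case True
  then show ?thesis by (simp add: deg_entry_def)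
next
  case False
  let ?M = "image_mset (degree E) (mset_set V)" and ?D = "degree_sequence V E"
  have m: "mset ?D = ?M" "sorted ?D" by (simp_all add: degree_sequence_def)
  have "length ?D = card V" using m(1) by (metis size_image_mset size_mset size_mset_set)
  moreover have "length (filter (\<lambda>x. x \<le> k) ?D) = size (filter_mset (\<lambda>x. x \<le> k) ?M)"
    by (metis m(1) mset_filter size_mset)
  moreover have "size (filter_mset (\<lambda>x. x \<le> k) ?M) = card {x \<in> V. degree E x \<le> k}"
    using assms(1) by (simp add: filter_mset_image_mset filter_mset_mset_set Collect_conj_eq)
  ultimately show ?thesis
    using sorted_nth_le_iff[OF m(2), of j k] False assms by (simp add: deg_entry_def)
qed

theorem theorem3p1:
  fixes V :: "'a set" and E :: "'a set set" and n :: nat and d :: "nat \<Rightarrow> nat"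
  assumes "simple_graph V E"
    and "n = card V" and "n \<ge> 3"
    and "d = deg_entry V E"
    and "odd n \<Longrightarrow> d ((n + 1) div 2) \<ge> (n + 1) div 2"
    and "even n \<Longrightarrow> d ((n - 2) div 2) \<ge> n div 2 \<or> d ((n + 2) div 2) \<ge> (n + 2) div 2"
    and "\<And>i::nat. real i \<le> (real n - 2) / 2 \<Longrightarrow> d i \<le> i \<Longrightarrow> d (i + 1) \<le> i + 1
           \<Longrightarrow> d (n - i - 1) \<ge> n - i - 1 \<or> d (n - i) \<ge> n - i"
    and "\<And>i::nat. 1 \<le> i \<Longrightarrow> real i \<le> (real n - 5) / 2 \<Longrightarrow> d (i - 1) \<le> i \<Longrightarrow> d (i + 2) \<le> i + 1
           \<Longrightarrow> d (n - i - 3) \<ge> n - i - 2 \<or> d (n - i) \<ge> n - i - 1"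
  shows "\<exists>F. two_factor V E F"
proof (rule ccontr)
  assume no: "\<not> ?thesis"
  define adj where "adj = (\<lambda>x y. {x, y} \<in> E)"
  have fin: "finite V" and E: "\<And>e. e \<in> E \<Longrightarrow> e \<subseteq> V \<and> card e = 2"
    using assms(1) by (auto simp: simple_graph_def)
  interpret graph_adj V adj
  proof
    show "finite V" by fact
    show "adj x y \<Longrightarrow> adj y x" for x y by (simp add: adj_def insert_commute)
    show "\<not> adj x x" for x using E[of "{x, x}"] by (auto simp: adj_def)
    show "adj x y \<Longrightarrow> x \<in> V" for x y using E[of "{x, y}"] by (auto simp: adj_def)
  qed
  have deg: "deg x = degree E x" for x
  proof -
    have "{e \<in> E. x \<in> e} = (\<lambda>y. {x, y}) ` nbhd x"
    proof
      show "(\<lambda>y. {x, y}) ` nbhd x \<subseteq> {e \<in> E. x \<in> e}"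
        unfolding nbhd_def by (auto simp: adj_def)
      show "{e \<in> E. x \<in> e} \<subseteq> (\<lambda>y. {x, y}) ` nbhd x"
      proof
        fix e assume e: "e \<in> {e \<in> E. x \<in> e}"
        then obtain a b where "e = {a, b}" using E[of e] by (auto simp: card_2_iff)
        then obtain y where "e = {x, y}" using e by auto
        then show "e \<in> (\<lambda>y. {x, y}) ` nbhd x"
          using e unfolding nbhd_def by (auto simp: adj_def)
      qed
    qed
    moreover have "inj_on (\<lambda>y. {x, y}) (nbhd x)" by (auto simp: inj_on_def doubleton_eq_iff)
    ultimately show ?thesis by (simp add: degree_def deg_def card_image)
  qed
  have "\<not> cycle_cover adj V"
  proof
    assume "cycle_cover adj V"
    then obtain F where F: "\<forall>e\<in>F. \<exists>x y. e = {x, y} \<and> adj x y \<and> x \<in> V \<and> y \<in> V"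
      "\<forall>v\<in>V. card {e \<in> F. v \<in> e} = 2" using cycle_cover_edges by blast
    have "F \<subseteq> E" using F(1) by (auto simp: adj_def)
    then have "two_factor V E F" using F(2) by (simp add: two_factor_def degree_def)
    then show False using no by blast
  qed
  then have bad: "bad_counts n (\<lambda>k. card {x \<in> V. degree E x \<le> k})" (is "bad_counts n ?c")
    using bad_counts_if_no_cover[OF graph_adj_axioms] assms(2,3) by (simp add: deg)
  have le: "d j \<le> k \<longleftrightarrow> j \<le> ?c k" if "j \<le> n" for j k
    using deg_entry_le_iff[OF fin] that assms(2,4) by blast
  from bad consider
      (i) "odd n" "(n + 1) div 2 \<le> ?c ((n - 1) div 2)"
    | (ii) "even n" "(n - 2) div 2 \<le> ?c (n div 2 - 1)" "(n + 2) div 2 \<le> ?c (n div 2)"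
    | (iii) i where "2 * i + 2 \<le> n" "i \<le> ?c i" "i + 1 \<le> ?c (i + 1)"
        "n - i - 1 \<le> ?c (n - i - 2)" "n - i \<le> ?c (n - i - 1)"
    | (iv) i where "1 \<le> i" "2 * i + 5 \<le> n" "i - 1 \<le> ?c i" "i + 2 \<le> ?c (i + 1)"
        "n - i - 3 \<le> ?c (n - i - 3)" "n - i \<le> ?c (n - i - 2)"
    unfolding bad_counts_def by blast
  then show False
  proof cases
    case i
    have "d ((n + 1) div 2) \<le> (n - 1) div 2" using i le assms(3) by auto
    then show False using assms(5)[OF i(1)] assms(3) by linarith
  next
    case ii
    have "d ((n - 2) div 2) \<le> n div 2 - 1" "d ((n + 2) div 2) \<le> n div 2"
      using ii le assms(3) by auto
    then show False using assms(6)[OF ii(1)] assms(3) by linarith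
  next
    case iii
    have d: "d i \<le> i" "d (i + 1) \<le> i + 1" "d (n - i - 1) \<le> n - i - 2" "d (n - i) \<le> n - i - 1"
      using iii le by auto
    have "real (2 * i + 2) \<le> real n" using iii(1) by (rule of_nat_mono)
    then have "real i \<le> (real n - 2) / 2" by simp
    from assms(7)[OF this d(1,2)] show False using d(3,4) iii(1) by linarith
  next
    case iv
    have d: "d (i - 1) \<le> i" "d (i + 2) \<le> i + 1" "d (n - i - 3) \<le> n - i - 3"
        "d (n - i) \<le> n - i - 2"
      using iv le by auto
    have "real (2 * i + 5) \<le> real n" using iv(2) by (rule of_nat_mono)
    then have "real i \<le> (real n - 5) / 2" by simp
    from assms(8)[OF iv(1) this d(1,2)] show False using d(3,4) iv(1,2) by linarith
  qed
qed

end
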